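(* Let $q=p^e$ be a prime power, $n$ a positive integer coprime to $q$, and $n'=p_1^{j_1}\cdots p_s^{j_s}$, where $p_1<\cdots<p_s$ are prime numbers different from $p$ and not dividing $n$, and $j_1,\dots,j_s$ are positive integers. Let $\gamma\in\mathbb{Z}$, let $c_n(\gamma)$ be the $q$-cyclotomic coset modulo $n$ containing $\gamma$, and let $\tau=|c_n(\gamma)|$. Then there is a one-to-one correspondence from the set $\mathcal{I}_{nn'/n}(\gamma)$ onto $\widehat{\pi}_{nn'/n}^{-1}(c_n(\gamma))$, the set of $q$-cyclotomic cosets modulo $nn'$ whose image under the canonical projection $\mathbb{Z}/nn'\mathbb{Z}\to\mathbb{Z}/n\mathbb{Z}$ is $c_n(\gamma)$.
   Context: Notation: $[a,b]$ is the set of integers from $a$ to $b$; $v_\ell$ is the $\ell$-adic valuation; $\overline{[0,j_k-1]}=[0,j_k-1]\cup\{\infty\}$. For $M\geq1$ coprime to $q$, the $q$-cyclotomic coset modulo $M$ containing $\gamma$ is $c_M(\gamma)=\{\gamma,\gamma q,\dots,\gamma q^{\tau-1}\}\subseteq\mathbb{Z}/M\mathbb{Z}$, where $\tau$ is the least positive integer with $\gamma q^\tau\equiv\gamma\pmod M$; its size is $|c_M(\gamma)|=\tau$. For $\mathfrak{m}=(m_1,\dots,m_s)$ with $m_k\in\overline{[0,j_k-1]}$, write $\mathfrak{m}_{\leq k}=(m_1,\dots,m_k)$ and define recursively: $\bullet$ $k=1$: $r_1=[(\mathbb{Z}/p_1\mathbb{Z})^*:\langle q^\tau\rangle]$; $v_1=v_2(q^\tau+1)$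 if $p_1=2$ and $q^\tau\equiv3\pmod4$, and $v_1=v_{p_1}(q^{\tau(p_1-1)/r_1}-1)$ otherwise. If $p_1=2$ and $q^\tau\equiv3\pmod 4$: $\tau_1(\mathfrak{m}_{\leq1})=\tau$ if $m_1\in\{j_1-1,\infty\}$ and $\tau_1(\mathfrak{m}_{\leq1})=2^{\max\{1,j_1-m_1-v_1\}}\tau$ if $0\leq m_1\leq j_1-2$. Otherwise: $\tau_1(\mathfrak{m}_{\leq1})=\tau$ if $m_1=\infty$ and $\tau_1(\mathfrak{m}_{\leq1})=p_1^{\max\{0,j_1-m_1-v_1\}}\frac{p_1-1}{r_1}\tau$ if $0\leq m_1\leq j_1-1$. $\bullet$ $2\leq k\leq s$: $r_k(\mathfrak{m}_{\leq k-1})=[(\mathbb{Z}/p_k\mathbb{Z})^*:\langle q^{\tau_{k-1}(\mathfrak{m}_{\leq k-1})}\rangle]$, $\widetilde\tau_k=\frac{\tau_{k-1}(\mathfrak{m}_{\leq k-1})(p_k-1)}{r_k(\mathfrak{m}_{\leq k-1})}$, $v_k(\mathfrak{m}_{\leq k-1})=v_{p_k}(q^{\widetilde\tau_k}-1)$; $\tau_k(\mathfrak{m}_{\leq k})=\tau_{k-1}(\mathfrak{m}_{\leq k-1})$ if $m_k=\infty$, and $\tau_k(\mathfrak{m}_{\leq k})=p_k^{\max\{0,j_k-m_k-v_k(\mathfrak{m}_{\leq k-1})\}}\frac{p_k-1}{r_k(\mathfrak{m}_{\leq k-1})}\tau_{k-1}(\mathfrak{m}_{\leq k-1})$ if $0\leq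 m_k\leq j_k-1$. $\mathcal{I}_{nn'/n}(\gamma;\mathfrak{m})$ is the set of pairs $(\mathfrak{a},\mathfrak{t})$, $\mathfrak{a}=(a_1,\dots,a_s)\in\mathbb{N}^s$, $\mathfrak{t}=(t_1,\dots,t_s)\in\mathbb{N}^s$ ($0\in\mathbb{N}$), satisfying: (i) for every $1\leq k\leq s$, if $m_k=\infty$ then $a_k=t_k=0$; (ii) if $m_1\in[0,j_1-1]$: when $p_1=2$ and $q^\tau\equiv3\pmod4$, $a_1=1$ and $t_1\in[0,2^{\max\{0,\min\{v_1-1,j_1-m_1-2\}\}}-1]$; otherwise $a_1\in[1,r_1]$ and $t_1\in[0,p_1^{\min\{v_1,j_1-m_1\}-1}-1]$; (iii) for every $2\leq k\leq s$, if $m_k\in[0,j_k-1]$ then $a_k\in[1,r_k(\mathfrak{m}_{\leq k-1})]$ and $t_k\in[0,p_k^{\min\{v_k(\mathfrak{m}_{\leq k-1}),j_k-m_k\}-1}-1]$. Finally $\mathcal{I}_{nn'/n}(\gamma)=\bigsqcup_{\mathfrak{m}}\mathcal{I}_{nn'/n}(\gamma;\mathfrak{m})$, over all $\mathfrak{m}\in\overline{[0,j_1-1]}\times\cdots\times\overline{[0,j_s-1]}$; i.e. its elements are triples $(\mathfrak{m},\mathfrak{a},\mathfrak{t})$. *)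

theory Defs
  imports
    "HOL-Number_Theory.Number_Theory"
    "HOL-Algebra.Generated_Groups"
    "HOL-Library.Extended_Nat"
    "HOL-Library.FuncSet"
begin

text \<open>
  Elements of \<open>\<int>/M\<int>\<close> are represented by their residues in \<open>{0..<M}\<close>; for \<open>n\<close> dividing \<open>M\<close> the
  canonical projection \<open>\<int>/M\<int> \<rightarrow> \<int>/n\<int>\<close> is then \<open>\<lambda>x. x mod n\<close>.
\<close>

definition cyc_period :: "nat \<Rightarrow> nat \<Rightarrow> int \<Rightarrow> nat" where
  "cyc_period q M \<gamma> = (LEAST t. 0 < t \<and> [\<gamma> * int q ^ t = \<gamma>] (mod int M))"

definition cyc_coset :: "nat \<Rightarrow> nat \<Rightarrow> int \<Rightarrow> int set" where
  "cyc_coset q M \<gamma> = (\<lambda>i. (\<gamma> * int q ^ i) mod int M) ` {0..<cyc_period q M \<gamma>}"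

definition cyc_cosets :: "nat \<Rightarrow> nat \<Rightarrow> int set set" where
  "cyc_cosets q M = range (cyc_coset q M)"

definition coset_proj :: "nat \<Rightarrow> int set \<Rightarrow> int set" where
  "coset_proj n C = (\<lambda>x. x mod int n) ` C"

definition coset_fiber :: "nat \<Rightarrow> nat \<Rightarrow> nat \<Rightarrow> int set \<Rightarrow> int set set" where
  "coset_fiber q n n' c = {C \<in> cyc_cosets q (n * n'). coset_proj n C = c}"

definition unit_group :: "nat \<Rightarrow> int monoid" where
  "unit_group p = units_of (residue_ring (int p))"

text \<open>The index \<open>[(\<int>/p\<int>)\<^sup>* : \<langle>x\<rangle>]\<close>, for \<open>x\<close> coprime to \<open>p\<close>.\<close>

definition unit_index :: "nat \<Rightarrow> nat \<Rightarrow> nat" where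
  "unit_index p x =
     card (rcosets\<^bsub>unit_group p\<^esub> (generate (unit_group p) {int x mod int p}))"

text \<open>
  Tuples \<open>(x\<^sub>1, \<dots>, x\<^sub>s)\<close> are functions on \<open>nat\<close> read at the arguments \<open>1, \<dots>, s\<close>; \<open>ps\<close> and \<open>js\<close> hold
  the primes \<open>p\<^sub>k\<close> and exponents \<open>j\<^sub>k\<close>.
\<close>

definition exc2 :: "nat \<Rightarrow> nat \<Rightarrow> (nat \<Rightarrow> nat) \<Rightarrow> nat \<Rightarrow> bool" where
  "exc2 q \<tau> ps k \<longleftrightarrow> k = 1 \<and> ps 1 = 2 \<and> [q ^ \<tau> = 3] (mod 4)"

text \<open>
  The quantities \<open>r\<^sub>k\<close>, \<open>v\<^sub>k\<close>, \<open>\<tau>\<^sub>k\<close>, which depend on \<open>m\<close> only through \<open>m\<^sub>1, \<dots>, m\<^bsub>k-1\<^esub>\<close>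
  (\<open>\<tau>\<^sub>k\<close> also on \<open>m\<^sub>k\<close>). Setting \<open>\<tau>\<^sub>0 = \<tau>\<close>, the formulas for \<open>k \<ge> 2\<close> also cover \<open>k = 1\<close> outside the
  exceptional case \<open>exc2\<close>. The values of \<open>r\<close> and \<open>v\<close> at \<open>0\<close> are dummies.
  Truncated subtraction on \<open>nat\<close> makes \<open>a - b\<close> equal to \<open>max {0, a - b}\<close>.
\<close>

fun tau_seq :: "nat \<Rightarrow> nat \<Rightarrow> (nat \<Rightarrow> nat) \<Rightarrow> (nat \<Rightarrow> nat) \<Rightarrow> (nat \<Rightarrow> enat) \<Rightarrow> nat \<Rightarrow> nat"
  and v_seq :: "nat \<Rightarrow> nat \<Rightarrow> (nat \<Rightarrow> nat) \<Rightarrow> (nat \<Rightarrow> nat) \<Rightarrow> (nat \<Rightarrow> enat) \<Rightarrow> nat \<Rightarrow> nat"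
  and r_seq :: "nat \<Rightarrow> nat \<Rightarrow> (nat \<Rightarrow> nat) \<Rightarrow> (nat \<Rightarrow> nat) \<Rightarrow> (nat \<Rightarrow> enat) \<Rightarrow> nat \<Rightarrow> nat"
where
  "r_seq q \<tau> ps js m 0 = 0"
| "r_seq q \<tau> ps js m (Suc k) = unit_index (ps (Suc k)) (q ^ tau_seq q \<tau> ps js m k)"
| "v_seq q \<tau> ps js m 0 = 0"
| "v_seq q \<tau> ps js m (Suc k) =
     (if exc2 q \<tau> ps (Suc k) then multiplicity 2 (q ^ \<tau> + 1)
      else multiplicity (ps (Suc k))
             (q ^ (tau_seq q \<tau> ps js m k * (ps (Suc k) - 1) div r_seq q \<tau> ps js m (Suc k)) - 1))"
| "tau_seq q \<tau> ps js m 0 = \<tau>"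
| "tau_seq q \<tau> ps js m (Suc k) =
     (case m (Suc k) of
        \<infinity> \<Rightarrow> tau_seq q \<tau> ps js m k
      | enat i \<Rightarrow>
          (if exc2 q \<tau> ps (Suc k) then
             (if i = js (Suc k) - 1 then \<tau>
              else 2 ^ max 1 (js (Suc k) - i - v_seq q \<tau> ps js m (Suc k)) * \<tau>)
           else ps (Suc k) ^ (js (Suc k) - i - v_seq q \<tau> ps js m (Suc k))
                * ((ps (Suc k) - 1) div r_seq q \<tau> ps js m (Suc k)) * tau_seq q \<tau> ps js m k))"

definition m_tuples :: "nat \<Rightarrow> (nat \<Rightarrow> nat) \<Rightarrow> (nat \<Rightarrow> enat) set" where
  "m_tuples s js = (\<Pi>\<^sub>E k\<in>{1..s}. enat ` {0..js k - 1} \<union> {\<infinity>})"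

definition at_tuples ::
  "nat \<Rightarrow> nat \<Rightarrow> nat \<Rightarrow> (nat \<Rightarrow> nat) \<Rightarrow> (nat \<Rightarrow> nat) \<Rightarrow> (nat \<Rightarrow> enat)
     \<Rightarrow> ((nat \<Rightarrow> nat) \<times> (nat \<Rightarrow> nat)) set" where
  "at_tuples q \<tau> s ps js m =
     {(a, t). a \<in> {1..s} \<rightarrow>\<^sub>E UNIV \<and> t \<in> {1..s} \<rightarrow>\<^sub>E UNIV \<and>
        (\<forall>k\<in>{1..s}.
           (case m k of
              \<infinity> \<Rightarrow> a k = 0 \<and> t k = 0
            | enat i \<Rightarrow>
                (if exc2 q \<tau> ps k then
                   a k = 1 \<and>
                   t k \<in> {0..2 ^ min (v_seq q \<tau> ps js m k - 1) (js k - i - 2) - 1}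
                 else
                   a k \<in> {1..r_seq q \<tau> ps js m k} \<and>
                   t k \<in> {0..ps k ^ (min (v_seq q \<tau> ps js m k) (js k - i) - 1) - 1})))}"

definition index_set ::
  "nat \<Rightarrow> nat \<Rightarrow> nat \<Rightarrow> (nat \<Rightarrow> nat) \<Rightarrow> (nat \<Rightarrow> nat)
     \<Rightarrow> ((nat \<Rightarrow> enat) \<times> (nat \<Rightarrow> nat) \<times> (nat \<Rightarrow> nat)) set" where
  "index_set q \<tau> s ps js = (SIGMA m : m_tuples s js. at_tuples q \<tau> s ps js m)"

end

theory Submission
  imports Defs
begin

text \<open>
  The primes \<open>p\<^sub>k\<close> are adjoined one at a time. Let \<open>D\<close> be a coset modulo \<open>N\<close> of size \<open>T\<close> and let \<open>p\<close>
  be a prime not dividing \<open>N q\<close>. By the Chinese remainder theorem, \<open>T \<cdot> \<phi>(p\<^bsup>j-i\<^esup>)\<close> residues modulo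
  \<open>N p\<^sup>j\<close> lie over \<open>D\<close> and have \<open>gcd\<close> equal to \<open>p\<^sup>i\<close> with \<open>p\<^sup>j\<close>, and each of them lies in a coset of
  size \<open>T \<cdot> ord(q\<^sup>T mod p\<^bsup>j-i\<^esup>)\<close>. The order is computed by lifting the exponent, and its quotient
  \<open>\<phi>(p\<^bsup>j-i\<^esup>) / ord(q\<^sup>T mod p\<^bsup>j-i\<^esup>)\<close> is exactly the number of admissible pairs \<open>(a, t)\<close>; the value
  \<open>i = j\<close> plays the role of \<open>m = \<infinity>\<close>. As the count depends on \<open>D\<close> only through \<open>T\<close>, the induction
  hypothesis carries the size \<open>\<tau>\<^sub>k\<close> of the coset attached to an index.
\<close>

section \<open>Multiplicative orders modulo prime powers\<close>

lemma power_eq_geometric_sum_nat: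
  fixes x :: nat
  assumes "x \<ge> 1"
  shows "x ^ n = 1 + (x - 1) * (\<Sum>i<n. x ^ i)"
proof (induction n)
  case (Suc n)
  have "x * x ^ n = x ^ n + (x - 1) * x ^ n"
    using assms by (cases x) auto
  with Suc show ?case by (simp add: algebra_simps)
qed simp

text \<open>Binomial terms of degree at least two in \<open>y\<close> vanish modulo
  \<open>p\<^sup>2\<close>.\<close>

lemma power_cong_linear:
  fixes y :: nat
  assumes "p dvd y"
  shows "[(1 + y) ^ i = 1 + i * y] (mod p\<^sup>2)"
proof (induction i)
  case (Suc i)
  have "[(1 + y) ^ Suc i = (1 + y) * (1 + i * y)] (mod p\<^sup>2)"
    using Suc by (simp add: cong_scalar_left del: One_nat_def)
  also have "(1 + y) * (1 + i * y) = 1 + Suc i * y + i * y\<^sup>2"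
    by (simp add: algebra_simps power2_eq_square)
  also have "[\<dots> = 1 + Suc i * y + 0] (mod p\<^sup>2)"
    using assms by (intro cong_add cong_refl) (simp add: cong_0_iff)
  finally show ?case by simp
qed simp

text \<open>Factor \<open>x ^ p - 1\<close> as \<open>(x - 1) * S\<close> with \<open>S\<close> the
  geometric sum. Modulo \<open>p\<^sup>2\<close> this sum is \<open>p\<close>, so it contributes
  exactly one factor \<open>p\<close>.\<close>

lemma multiplicity_power_prime_minus_1:
  fixes x :: nat
  assumes p: "prime p" and x: "x > 1" and pd: "p dvd x - 1" and odd4: "p \<noteq> 2 \<or> 4 dvd x - 1"
  shows "multiplicity p (x ^ p - 1) = Suc (multiplicity p (x - 1))"
proof -
  define y where "y = x - 1"
  define S where "S = (\<Sum>i<p. x ^ i)"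
  have xy: "x = 1 + y" and "y > 0" using x by (auto simp: y_def)
  have "p dvd y" using pd by (simp add: y_def)
  have sum: "[S = p + y * (\<Sum>i<p. i)] (mod p\<^sup>2)"
  proof -
    have "[S = (\<Sum>i<p. 1 + i * y)] (mod p\<^sup>2)"
      unfolding S_def xy by (intro cong_sum power_cong_linear \<open>p dvd y\<close>)
    also have "(\<Sum>i<p. 1 + i * y) = p + y * (\<Sum>i<p. i)"
      by (simp only: sum.distrib sum_distrib_left) (simp add: mult.commute)
    finally show ?thesis .
  qed
  \<comment> \<open>For odd \<open>p\<close> the sum is a multiple of \<open>p\<close> and
    \<open>y\<close> supplies the other factor. For \<open>p = 2\<close> the sum is 1, so both
    factors must come from \<open>y\<close>, which is what \<open>4 dvd x - 1\<close>
    provides.\<close>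
  have "p\<^sup>2 dvd y * (\<Sum>i<p. i)"
  proof (cases "p = 2")
    case True
    have "(\<Sum>i<2. i) = (1::nat)" by (simp add: numeral_2_eq_2)
    with True odd4 show ?thesis by (simp add: y_def)
  next
    case False
    then have "odd p" using p prime_odd_nat prime_ge_2_nat[OF p] by auto
    then obtain h where h: "p = 2 * h + 1" by (auto elim: oddE)
    have "2 * (\<Sum>i<2 * h + 1. i) = (2 * h + 1) * (2 * h)"
      by (induction h) auto
    then have "(\<Sum>i<p. i) = p * h" by (simp add: h algebra_simps)
    then show ?thesis using \<open>p dvd y\<close> by (simp add: power2_eq_square mult_dvd_mono)
  qed
  then have S: "[S = p] (mod p\<^sup>2)"
    using cong_trans[OF sum] by (metis add.right_neutral cong_0_iff cong_add_lcancel_nat)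
  have "p dvd S" using S
    by (metis cong_dvd_iff cong_dvd_modulus_nat dvd_refl dvd_power pos2)
  then obtain w where w: "S = p * w" ..
  have "\<not> p dvd w"
  proof
    assume "p dvd w"
    then have "p\<^sup>2 dvd S" by (simp add: w power2_eq_square mult_dvd_mono)
    then have "p\<^sup>2 dvd p" using S cong_dvd_iff by blast
    then show False using p prime_gt_1_nat[OF p]
      by (metis dvd_imp_le less_le_not_le one_less_numeral_iff power_one_right power_strict_increasing_iff
            prime_gt_0_nat semiring_norm(76))
  qed
  have "x ^ p - 1 = y * S"
    using power_eq_geometric_sum_nat[of x p] x by (simp add: S_def y_def)
  then have "multiplicity p (x ^ p - 1) = multiplicity p (p * (y * w))"
    by (simp add: w mult_ac)
  also have "\<dots> = Suc (multiplicity p (y * w))"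
    using \<open>y > 0\<close> \<open>\<not> p dvd w\<close> p by (intro multiplicity_times_same) (auto intro!: Nat.gr0I)
  also have "multiplicity p (y * w) = multiplicity p y"
    using \<open>\<not> p dvd w\<close> p \<open>y > 0\<close> 
    by (subst mult.commute, intro multiplicity_prime_elem_times_other) auto
  finally show ?thesis by (simp add: y_def)
qed

text \<open>Each further \<open>p\<close>-th power adds one. The divisibility hypotheses are
  inherited because \<open>x - 1\<close> divides \<open>x ^ p ^ a - 1\<close>.\<close>

lemma multiplicity_power_prime_power_minus_1:
  fixes x :: nat
  assumes p: "prime p" and x: "x > 1" and pd: "p dvd x - 1" and odd4: "p \<noteq> 2 \<or> 4 dvd x - 1"
  shows "multiplicity p (x ^ p ^ a - 1) = multiplicity p (x - 1) + a"
proof (induction a)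
  case (Suc a)
  let ?y = "x ^ p ^ a"
  have dvd: "x - 1 dvd ?y - 1"
    using power_eq_geometric_sum_nat[of x "p ^ a"] x by simp
  have "?y > 1" using x p by (intro one_less_power) (auto simp: prime_gt_0_nat)
  have "x ^ p ^ Suc a = ?y ^ p" by (simp add: mult.commute flip: power_mult)
  moreover have "multiplicity p (?y ^ p - 1) = Suc (multiplicity p (?y - 1))"
    using p \<open>?y > 1\<close> odd4 dvd_trans[OF pd dvd] dvd_trans[OF _ dvd, of 4]
    by (intro multiplicity_power_prime_minus_1) auto
  ultimately show ?case using Suc by simp
qed simp

section \<open>From valuations to orders\<close>

lemma cong_1_iff_dvd_nat: "(x::nat) \<ge> 1 \<Longrightarrow> [x = 1] (mod m) \<longleftrightarrow> m dvd x - 1"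
  using cong_altdef_nat cong_sym_eq by metis

text \<open>With \<open>v\<close> the valuation of \<open>x - 1\<close>, the order divides
  \<open>p ^ a\<close> exactly when \<open>d \<le> v + a\<close>, so it is \<open>p ^ a\<close> for
  the least such \<open>a\<close>.\<close>

lemma ord_prime_power_of_1_mod_prime:
  fixes x :: nat
  assumes p: "prime p" and x: "x > 1" and pd: "p dvd x - 1" and odd4: "p \<noteq> 2 \<or> 4 dvd x - 1"
  shows "ord (p ^ d) x = p ^ (d - multiplicity p (x - 1))"
proof -
  define v where "v = multiplicity p (x - 1)"
  have iff: "ord (p ^ d) x dvd p ^ a \<longleftrightarrow> d \<le> v + a" for a
  proof -
    have gt: "x ^ p ^ a > 1" using x p by (intro one_less_power) (auto simp: prime_gt_0_nat)
    have "ord (p ^ d) x dvd p ^ a \<longleftrightarrow> p ^ d dvd x ^ p ^ a - 1"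
      using gt by (subst ord_divides[symmetric], intro cong_1_iff_dvd_nat) simp
    also have "\<dots> \<longleftrightarrow> d \<le> multiplicity p (x ^ p ^ a - 1)"
      using gt p by (intro power_dvd_iff_le_multiplicity) (auto intro!: Nat.gr0I)
    finally show ?thesis
      using multiplicity_power_prime_power_minus_1[OF assms, of a] by (simp add: v_def)
  qed
  have "ord (p ^ d) x dvd p ^ (d - v)" by (simp add: iff)
  then obtain b where b: "b \<le> d - v" "ord (p ^ d) x = p ^ b"
    using divides_primepow_nat[OF p] by blast
  have "d \<le> v + b" using iff[of b] b by simp
  with b have "b = d - v" by simp
  with b show ?thesis by (simp add: v_def)
qed

lemma ord_mult_ord_power:
  fixes a :: nat
  assumes "k dvd ord m a"
  shows "ord m a = k * ord m (a ^ k)"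
  using ord_power_aux[of m a k] assms by (simp add: gcd_nat.absorb1 mult.commute)

lemma ord_dvd_ord_modulus:
  fixes a :: nat
  assumes "m dvd n"
  shows "ord m a dvd ord n a"
  using assms cong_dvd_modulus_nat ord ord_divides by blast

text \<open>The order modulo \<open>p\<close> divides the order modulo \<open>p ^ d\<close>. Raising
  \<open>Q\<close> to it gives a base that is 1 modulo \<open>p\<close>, to which lifting the
  exponent applies.\<close>

lemma ord_prime_power:
  fixes Q :: nat
  assumes p: "prime p" and cop: "coprime p Q" and Q: "Q > 1" and d: "d \<ge> 1"
    and odd4: "p \<noteq> 2 \<or> [Q = 1] (mod 4)"
  shows "ord (p ^ d) Q = ord p Q * p ^ (d - multiplicity p (Q ^ ord p Q - 1))"
proof -
  have "ord p Q dvd ord (p ^ d) Q" using d by (intro ord_dvd_ord_modulus dvd_power) auto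
  then have "ord (p ^ d) Q = ord p Q * ord (p ^ d) (Q ^ ord p Q)"
    by (rule ord_mult_ord_power)
  also have "ord (p ^ d) (Q ^ ord p Q) = p ^ (d - multiplicity p (Q ^ ord p Q - 1))"
  proof (rule ord_prime_power_of_1_mod_prime)
    have pos: "ord p Q > 0" using cop by simp
    then show gt: "Q ^ ord p Q > 1" using Q one_less_power by blast
    show "p dvd Q ^ ord p Q - 1"
      using ord[of Q p] cong_1_iff_dvd_nat gt by (meson less_imp_le)
    show "p \<noteq> 2 \<or> 4 dvd Q ^ ord p Q - 1"
      using odd4 cong_pow[of Q 1 4 "ord p Q"] cong_1_iff_dvd_nat[of "Q ^ ord p Q" 4] gt by auto
  qed (rule p)
  finally show ?thesis .
qed

text \<open>Lifting the exponent fails for \<open>Q\<close> but applies to \<open>Q\<^sup>2\<close>,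
  and the order is even once \<open>d \<ge> 2\<close>. As \<open>Q - 1\<close> is divisible by 2
  exactly once, the valuation of \<open>Q\<^sup>2 - 1\<close> is one more than that of
  \<open>Q + 1\<close>.\<close>

lemma ord_two_power_3_mod_4:
  fixes Q :: nat
  assumes Q: "[Q = 3] (mod 4)"
  shows "ord (2 ^ d) Q = (if d \<le> 1 then 1 else 2 ^ max 1 (d - multiplicity 2 (Q + 1)))"
proof -
  have "odd Q"
    using cong_dvd_modulus_nat[OF Q, of 2] by (simp add: cong_def odd_iff_mod_2_eq_one)
  have "Q \<ge> 3" using Q by (cases "Q < 4") (auto simp: cong_def)
  consider "d = 0" | "d = 1" | "d \<ge> 2" by linarith
  then show ?thesis
  proof cases
    case 2
    then show ?thesis using \<open>odd Q\<close> by (simp add: ord_eq_Suc_0_iff cong_def odd_iff_mod_2_eq_one)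
  next
    case 3
    have "(4::nat) dvd 2 ^ d" using le_imp_power_dvd[OF 3, of "2::nat"] by simp
    moreover have "ord 4 Q = 2" using ord_cong[OF Q] by simp
    ultimately have two: "2 dvd ord (2 ^ d) Q" using ord_dvd_ord_modulus by metis
    have sq: "Q\<^sup>2 - 1 = (Q - 1) * (Q + 1)"
      by (simp add: algebra_simps power2_eq_square)
    define k where "k = Q div 4"
    have "Q mod 4 = 3" using Q by (simp add: cong_def)
    then have k: "Q = 4 * k + 3" unfolding k_def by presburger
    have "Q - 1 = 2 * (2 * k + 1)" by (simp add: k)
    then have "multiplicity 2 (Q - 1) = Suc (multiplicity 2 (2 * k + 1))"
      by (simp only:) (rule multiplicity_times_same, auto)
    also have "multiplicity 2 (2 * k + 1) = 0"
      by (rule not_dvd_imp_multiplicity_0) simp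
    finally have m1: "multiplicity 2 (Q - 1) = 1" by simp
    have "multiplicity 2 (Q\<^sup>2 - 1) = multiplicity 2 (Q - 1) + multiplicity 2 (Q + 1)"
      unfolding sq using \<open>Q \<ge> 3\<close> by (intro prime_elem_multiplicity_mult_distrib) auto
    then have v: "multiplicity 2 (Q\<^sup>2 - 1) = Suc (multiplicity 2 (Q + 1))" using m1 by simp
    have "ord (2 ^ d) Q = 2 * ord (2 ^ d) (Q\<^sup>2)"
      using two by (rule ord_mult_ord_power)
    also have "ord (2 ^ d) (Q\<^sup>2) = 2 ^ (d - multiplicity 2 (Q\<^sup>2 - 1))"
    proof (rule ord_prime_power_of_1_mod_prime)
      show "1 < Q\<^sup>2" using \<open>Q \<ge> 3\<close> by (intro one_less_power) auto
      have "4 dvd Q + 1" using k by presburger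
      then have "4 dvd Q\<^sup>2 - 1" unfolding sq by (rule dvd_mult)
      then show "2 \<noteq> (2::nat) \<or> 4 dvd Q\<^sup>2 - 1" by simp
      show "2 dvd Q\<^sup>2 - 1" by (rule dvd_trans[OF _ \<open>4 dvd Q\<^sup>2 - 1\<close>]) simp
    qed simp
    \<comment> \<open>With \<open>v\<close> the valuation of \<open>Q + 1\<close>, truncated
      subtraction makes \<open>Suc (d - Suc v)\<close> equal to
      \<open>max 1 (d - v)\<close>.\<close>
    also have "2 * 2 ^ (d - multiplicity 2 (Q\<^sup>2 - 1)) = (2::nat) ^ max 1 (d - multiplicity 2 (Q + 1))"
      unfolding v power_Suc[symmetric] by (rule arg_cong[of _ _ "(^) 2"]) simp
    finally show ?thesis using 3 by simp
  qed simp
qed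

section \<open>Indices in the unit group modulo a prime\<close>

lemma unit_index_mult_ord:
  assumes p: "prime p" and cop: "coprime p Q"
  shows "unit_index p Q * ord p Q = p - 1"
proof -
  interpret residues_prime p "residue_ring (int p)" by (rule residues_prime.intro) (fact p)
  let ?R = "residue_ring (int p)"
  let ?U = "unit_group p"
  define g where "g = int Q mod int p"
  have "int p > 1" using prime_gt_1_nat[OF p] by simp
  have gU: "g \<in> carrier ?U"
    unfolding g_def unit_group_def units_of_carrier
    using cop \<open>int p > 1\<close> by (intro mod_in_res_units) (auto simp: coprime_commute)
  interpret U: group ?U unfolding unit_group_def by (rule units_group)
  have fin: "finite (carrier ?U)" unfolding unit_group_def units_of_carrier by simp
  have "g [^]\<^bsub>?U\<^esub> i = int (Q ^ i mod p)" for i :: nat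
  proof -
    have "g [^]\<^bsub>?U\<^esub> i = g [^]\<^bsub>?R\<^esub> i"
      using gU unfolding unit_group_def by (intro units_of_pow) (simp add: units_of_carrier)
    then show ?thesis by (simp add: g_def pow_cong zmod_int)
  qed
  then have gen: "generate ?U {g} = (\<lambda>i. int (Q ^ i mod p)) ` UNIV"
    using U.generate_pow_on_finite_carrier[OF fin gU] by auto
  \<comment> \<open>The powers of \<open>Q\<close> repeat with period \<open>ord p Q\<close> and are
    distinct within one period. This gives the size of the generated subgroup, and Lagrange's
    theorem gives its index.\<close>
  have "(\<lambda>i. Q ^ i mod p) ` UNIV = (\<lambda>i. Q ^ i mod p) ` {..<Pocklington.ord p Q}"
  proof (intro equalityI image_subsetI)
    fix i
    have "[Q ^ i = Q ^ (i mod Pocklington.ord p Q)] (mod p)"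
      using order_divides_expdiff[of p Q i "i mod Pocklington.ord p Q"] cop by (simp add: cong_def)
    then have "Q ^ i mod p = Q ^ (i mod Pocklington.ord p Q) mod p" by (simp only: cong_def)
    moreover have "i mod Pocklington.ord p Q \<in> {..<Pocklington.ord p Q}" using cop by simp
    ultimately show "Q ^ i mod p \<in> (\<lambda>i. Q ^ i mod p) ` {..<Pocklington.ord p Q}"
      by (rule image_eqI)
  qed auto
  then have "generate ?U {g} = int ` (\<lambda>i. Q ^ i mod p) ` {..<Pocklington.ord p Q}"
    unfolding gen by (simp only: image_image[symmetric, of int "\<lambda>i. Q ^ i mod p"])
  then have "card (generate ?U {g}) = Pocklington.ord p Q"
    using cop by (simp add: card_image inj_power_mod)
  moreover have "subgroup (generate ?U {g}) ?U" using gU by (intro U.generate_is_subgroup) auto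
  moreover have "order ?U = p - 1"
    unfolding order_def unit_group_def units_of_carrier res_prime_units_eq by simp
  ultimately show ?thesis
    using U.lagrange[of "generate ?U {g}"] by (simp only: g_def unit_index_def)
qed

section \<open>Cyclotomic cosets\<close>

lemma dvd_mult_iff_div_gcd:
  fixes m x y :: int
  assumes "m \<noteq> 0"
  shows "m dvd x * y \<longleftrightarrow> m div gcd x m dvd y"
proof -
  obtain x' m' where *: "x = x' * gcd x m" "m = m' * gcd x m" "coprime x' m'"
    using gcd_coprime_exists[of x m] assms by auto
  have g: "gcd x m \<noteq> 0" using assms by simp
  have "m div gcd x m = m'" using *(2) g by (metis nonzero_mult_div_cancel_right)
  moreover have "m dvd x * y \<longleftrightarrow> m' * gcd x m dvd (x' * y) * gcd x m"
    by (metis * mult.assoc mult.commute)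
  moreover have "\<dots> \<longleftrightarrow> m' dvd x' * y" using g by (rule dvd_times_right_cancel_iff)
  moreover have "\<dots> \<longleftrightarrow> m' dvd y"
    using *(3) by (intro coprime_dvd_mult_right_iff) (simp add: coprime_commute)
  ultimately show ?thesis by simp
qed

text \<open>\<open>M\<close> divides \<open>x * (q ^ t - 1)\<close> exactly when
  \<open>q ^ t\<close> is 1 modulo the quotient of \<open>M\<close> by its gcd with
  \<open>x\<close>. All return times are described, not only the least, so that conditions for two
  moduli can be combined.\<close>

lemma cong_mult_self_iff_ord_dvd:
  assumes "M > 0"
  shows "[x * int q ^ t = x] (mod int M) \<longleftrightarrow> ord (M div nat (gcd x (int M))) q dvd t"
proof -
  let ?g = "gcd x (int M)"
  have g: "int (nat ?g) = ?g" by simp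
  have "[x * int q ^ t = x] (mod int M) \<longleftrightarrow> int M dvd x * (int q ^ t - 1)"
    by (simp add: cong_iff_dvd_diff algebra_simps)
  also have "\<dots> \<longleftrightarrow> int M div ?g dvd int q ^ t - 1"
    using assms by (intro dvd_mult_iff_div_gcd) simp
  also have "\<dots> \<longleftrightarrow> [int (q ^ t) = int 1] (mod int (M div nat ?g))"
    by (simp add: cong_iff_dvd_diff zdiv_int)
  also have "\<dots> \<longleftrightarrow> ord (M div nat ?g) q dvd t"
    by (simp only: cong_int_iff ord_divides)
  finally show ?thesis .
qed

lemma ord_div_gcd_pos:
  assumes "M > 0" "coprime M q"
  shows "ord (M div nat (gcd x (int M))) q > 0"
proof -
  have "nat (gcd x (int M)) dvd M"
    by (subst int_dvd_int_iff[symmetric]) simp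
  then have "M div nat (gcd x (int M)) dvd M" by (metis dvd_div_mult_self dvd_triv_left)
  then show ?thesis using assms(2) by (metis coprime_divisors dvd_refl ord_gt_0_iff)
qed

lemma cyc_period_eq_ord:
  assumes "M > 0" "coprime M q"
  shows "cyc_period q M x = ord (M div nat (gcd x (int M))) q"
  unfolding cyc_period_def cong_mult_self_iff_ord_dvd[OF assms(1)]
  by (rule Least_equality) (use ord_div_gcd_pos[OF assms] in \<open>auto dest: dvd_imp_le\<close>)

lemma cyc_period_pos: "M > 0 \<Longrightarrow> coprime M q \<Longrightarrow> cyc_period q M x > 0"
  by (simp only: cyc_period_eq_ord ord_div_gcd_pos)

lemma cong_iff_cyc_period_dvd:
  "M > 0 \<Longrightarrow> coprime M q \<Longrightarrow> [x * int q ^ t = x] (mod int M) \<longleftrightarrow> cyc_period q M x dvd t"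
  by (simp only: cyc_period_eq_ord cong_mult_self_iff_ord_dvd)

text \<open>Exponents can be reduced modulo the period. The unrestricted range presents the coset as
  an orbit, and projections to smaller moduli commute with it although the periods differ.\<close>

lemma cyc_coset_eq_range:
  assumes "M > 0" "coprime M q"
  shows "cyc_coset q M x = range (\<lambda>i. x * int q ^ i mod int M)"
proof -
  let ?P = "cyc_period q M x"
  have "x * int q ^ i mod int M \<in> cyc_coset q M x" for i
  proof -
    have "[x * int q ^ (?P * (i div ?P)) = x] (mod int M)"
      by (simp add: cong_iff_cyc_period_dvd[OF assms])
    from cong_scalar_right[OF this, of "int q ^ (i mod ?P)"]
    have "[x * int q ^ i = x * int q ^ (i mod ?P)] (mod int M)"
      by (simp add: mult.assoc flip: power_add)
    moreover have "i mod ?P \<in> {0..<?P}" using cyc_period_pos[OF assms] by simp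
    ultimately show ?thesis unfolding cyc_coset_def cong_def by (rule image_eqI)
  qed
  then show ?thesis by (auto simp: cyc_coset_def)
qed

text \<open>Powers of \<open>q\<close> can be cancelled modulo \<open>M\<close>, so a repetition
  among the listed elements would give a return time shorter than the period.\<close>

lemma card_cyc_coset:
  assumes "M > 0" "coprime M q"
  shows "card (cyc_coset q M x) = cyc_period q M x"
proof -
  let ?P = "cyc_period q M x"
  have cop: "coprime (int q ^ i) (int M)" for i
    using assms(2) by (simp add: coprime_commute)
  have *: "i = j" if "i \<le> j" "j < ?P" "[x * int q ^ i = x * int q ^ j] (mod int M)" for i j
  proof -
    have "[x * int q ^ (j - i) * int q ^ i = x * int q ^ i] (mod int M)"
      using that by (simp add: mult.assoc cong_sym_eq flip: power_add)
    then have "[x * int q ^ (j - i) = x] (mod int M)"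
      using cop by (simp add: cong_mult_rcancel)
    then have "?P dvd j - i" by (simp only: cong_iff_cyc_period_dvd[OF assms])
    with that show "i = j" using nat_dvd_not_less[of "j - i" ?P] by (cases "i = j") auto
  qed
  have "inj_on (\<lambda>i. x * int q ^ i mod int M) {0..<?P}"
  proof (rule inj_onI)
    fix i j assume "i \<in> {0..<?P}" "j \<in> {0..<?P}" "x * int q ^ i mod int M = x * int q ^ j mod int M"
    then show "i = j" using *[of i j] *[of j i] by (cases "i \<le> j") (auto simp: cong_def)
  qed
  then show ?thesis by (simp add: cyc_coset_def card_image)
qed

lemma cyc_coset_mod: "M > 0 \<Longrightarrow> coprime M q \<Longrightarrow> cyc_coset q M (x mod int M) = cyc_coset q M x"
  by (simp add: cyc_coset_eq_range mod_mult_left_eq)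

lemma mod_in_cyc_coset: "M > 0 \<Longrightarrow> coprime M q \<Longrightarrow> x mod int M \<in> cyc_coset q M x"
  unfolding cyc_coset_eq_range by (rule range_eqI[of _ _ 0]) simp

lemma cyc_coset_subset: "M > 0 \<Longrightarrow> cyc_coset q M x \<subseteq> {0..<int M}"
  by (auto simp: cyc_coset_def)

lemma cyc_coset_eq_if_mem:
  assumes "M > 0" "coprime M q" "y \<in> cyc_coset q M x"
  shows "cyc_coset q M y = cyc_coset q M x"
proof -
  obtain i where y: "y = x * int q ^ i mod int M"
    using assms by (auto simp: cyc_coset_eq_range)
  have eq: "y * int q ^ k mod int M = x * int q ^ (i + k) mod int M" for k
    by (simp add: y mod_mult_left_eq power_add mult.assoc)
  define P where "P = cyc_period q M x"
  have "P \<ge> 1" using cyc_period_pos[OF assms(1,2)] by (simp add: P_def Suc_le_eq)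
  \<comment> \<open>The exponent \<open>P * i - i\<close> undoes the multiplication by
    \<open>q ^ i\<close>, since \<open>q ^ (P * i)\<close> fixes \<open>x\<close>. From
    \<open>P \<ge> 1\<close> the subtraction does not truncate.\<close>
  have "x * int q ^ k mod int M = y * int q ^ (P * i - i + k) mod int M" for k
  proof -
    have "[x * int q ^ (P * i) = x] (mod int M)"
      by (simp add: cong_iff_cyc_period_dvd[OF assms(1,2)] P_def)
    from cong_scalar_right[OF this, of "int q ^ k"]
    have "[x * int q ^ (P * i + k) = x * int q ^ k] (mod int M)"
      by (simp add: mult.assoc power_add)
    moreover have "i \<le> P * i" using mult_le_mono1[OF \<open>P \<ge> 1\<close>, of i] by simp
    then have "i + (P * i - i + k) = P * i + k"
      by (simp only: add.assoc[symmetric] le_add_diff_inverse)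
    ultimately show ?thesis by (simp only: eq cong_def)
  qed
  then show ?thesis using eq assms(1,2) by (auto simp: cyc_coset_eq_range)
qed

lemma cyc_cosets_eq_if_mem:
  "M > 0 \<Longrightarrow> coprime M q \<Longrightarrow> C \<in> cyc_cosets q M \<Longrightarrow> x \<in> C \<Longrightarrow> C = cyc_coset q M x"
  unfolding cyc_cosets_def using cyc_coset_eq_if_mem by blast

lemma cyc_cosets_nonempty: "M > 0 \<Longrightarrow> coprime M q \<Longrightarrow> C \<in> cyc_cosets q M \<Longrightarrow> \<exists>x. x \<in> C"
  unfolding cyc_cosets_def using mod_in_cyc_coset by blast

lemma coset_proj_cyc_coset:
  assumes "N > 0" "P > 0" "coprime (N * P) q"
  shows "coset_proj N (cyc_coset q (N * P) x) = cyc_coset q N x"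
proof -
  have "coprime N q" using assms(3) by simp
  with assms show ?thesis
    by (simp add: coset_proj_def cyc_coset_eq_range image_image mod_mod_cancel)
qed

text \<open>Cosets are determined by any one of their elements, so a single element over
  \<open>D\<close> forces the whole projection to be \<open>D\<close>.\<close>

lemma coset_fiber_iff:
  assumes "N > 0" "P > 0" "coprime (N * P) q" "D \<in> cyc_cosets q N"
  shows "E \<in> coset_fiber q N P D \<longleftrightarrow> E \<in> cyc_cosets q (N * P) \<and> (\<exists>x\<in>E. x mod int N \<in> D)"
proof -
  have cop: "coprime N q" using assms(3) by simp
  have pos: "N * P > 0" using assms by simp
  have "coset_proj N E = D \<longleftrightarrow> (\<exists>x\<in>E. x mod int N \<in> D)" if E: "E \<in> cyc_cosets q (N * P)"
  proof
    assume "coset_proj N E = D"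
    then show "\<exists>x\<in>E. x mod int N \<in> D"
      using cyc_cosets_nonempty[OF pos assms(3) E] by (auto simp: coset_proj_def)
  next
    assume "\<exists>x\<in>E. x mod int N \<in> D"
    then obtain x where x: "x \<in> E" "x mod int N \<in> D" by blast
    have "E = cyc_coset q (N * P) x" using cyc_cosets_eq_if_mem[OF pos assms(3) E x(1)] .
    moreover have "D = cyc_coset q N (x mod int N)" 
      using cyc_cosets_eq_if_mem[OF assms(1) cop assms(4) x(2)] .
    ultimately show "coset_proj N E = D"
      using assms cop by (simp add: coset_proj_cyc_coset cyc_coset_mod)
  qed
  then show ?thesis by (auto simp: coset_fiber_def)
qed

section \<open>Counting the cosets that lie over a given one\<close>

lemma card_residues_gcd:
  assumes "d dvd m" "m > 0"
  shows "card {y \<in> {0..<int m}. gcd y (int m) = int d} = totient (m div d)"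
proof -
  define A where "A = {k \<in> {0<..<m}. gcd k m = d}"
  have fin: "finite A" "0 \<notin> A" "m \<notin> A" by (auto simp: A_def)
  \<comment> \<open>Both \<open>0\<close> and \<open>m\<close> have gcd \<open>m\<close> with
    \<open>m\<close>. Exchanging them carries the residues to the range on which
    \<open>card_gcd_eq_totient\<close> counts.\<close>
  have 1: "{k \<in> {0..<m}. gcd k m = d} = (if d = m then insert 0 A else A)"
    using assms(2) by (auto simp: A_def intro!: Nat.gr0I)
  have 2: "{k \<in> {0<..m}. gcd k m = d} = (if d = m then insert m A else A)"
    using assms(2) by (auto simp: A_def order_le_less)
  have "{y \<in> {0..<int m}. gcd y (int m) = int d} = int ` {k \<in> {0..<m}. gcd k m = d}"
  proof (intro equalityI subsetI)
    fix y assume "y \<in> {y \<in> {0..<int m}. gcd y (int m) = int d}"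
    moreover from this obtain k where "y = int k" using zero_le_imp_eq_int by auto
    ultimately show "y \<in> int ` {k \<in> {0..<m}. gcd k m = d}" by (intro image_eqI[of _ _ k]) simp_all
  qed auto
  then have "card {y \<in> {0..<int m}. gcd y (int m) = int d} = card {k \<in> {0..<m}. gcd k m = d}"
    by (simp add: card_image)
  also have "\<dots> = card {k \<in> {0<..m}. gcd k m = d}"
    unfolding 1 2 using fin by simp
  also have "\<dots> = totient (m div d)" by (rule card_gcd_eq_totient) (use assms in auto)
  finally show ?thesis .
qed

text \<open>By the Chinese remainder theorem, reduction modulo \<open>N\<close> and modulo
  \<open>P\<close> maps these residues bijectively onto \<open>D \<times> Y\<close>.\<close>

lemma card_residues_product:
  assumes "N > 0" "P > 0" "coprime N P" "D \<subseteq> {0..<int N}" "Y \<subseteq> {0..<int P}"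
  shows "card {x \<in> {0..<int (N * P)}. x mod int N \<in> D \<and> x mod int P \<in> Y} = card D * card Y"
proof -
  let ?S = "{x \<in> {0..<int (N * P)}. x mod int N \<in> D \<and> x mod int P \<in> Y}"
  let ?f = "\<lambda>x. (x mod int N, x mod int P)"
  have cop: "coprime (int N) (int P)" using assms(3) by simp
  have inj: "inj_on ?f ?S"
  proof (rule inj_onI)
    fix x y assume xy: "x \<in> ?S" "y \<in> ?S" "?f x = ?f y"
    then have "[x = y] (mod int N * int P)"
      using cop by (intro coprime_cong_mult) (auto simp: cong_def)
    with xy show "x = y" by (auto simp: cong_def)
  qed
  have img: "?f ` ?S = D \<times> Y"
  proof (intro equalityI subsetI)
    fix z assume "z \<in> D \<times> Y"
    then obtain d y where z: "z = (d, y)" "d \<in> D" "y \<in> Y" by auto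
    obtain x where x: "[x = d] (mod int N)" "[x = y] (mod int P)"
      using binary_chinese_remainder_int[OF cop] by blast
    have d: "x mod int N = d" "x mod int P = y"
      using x z assms(4,5) by (auto simp: cong_def subset_iff)
    define w where "w = x mod int (N * P)"
    have w: "w mod int N = d" "w mod int P = y"
      using d by (simp_all add: w_def mod_mod_cancel)
    have "w \<in> {0..<int (N * P)}" using assms(1,2) unfolding w_def by (simp del: of_nat_mult)
    with w z show "z \<in> ?f ` ?S" by (intro image_eqI[of _ _ w]) auto
  qed auto
  have "card ?S = card (D \<times> Y)" unfolding img[symmetric] by (rule card_image[OF inj, symmetric])
  then show ?thesis by (simp add: card_cartesian_product)
qed

text \<open>Powers of \<open>q\<close> are units modulo \<open>P\<close>, so the gcd with
  \<open>P\<close> is an invariant of a coset and can be used to split a fiber.\<close>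

lemma gcd_cyc_coset:
  assumes "N > 0" "P > 0" "coprime (N * P) q" "y \<in> cyc_coset q (N * P) x"
  shows "gcd y (int P) = gcd x (int P)"
proof -
  obtain i where y: "y = x * int q ^ i mod int (N * P)"
    using assms by (auto simp: cyc_coset_eq_range)
  have "y mod int P = x * int q ^ i mod int P" by (simp add: y mod_mod_cancel)
  then have "gcd y (int P) = gcd (x * int q ^ i) (int P)"
    by (metis gcd_red_int gcd.commute)
  also have "\<dots> = gcd x (int P)"
    using assms(3) by (intro gcd_mult_right_right_cancel gcd_mult_left_right_cancel) (auto simp: coprime_commute)
  finally show ?thesis .
qed

text \<open>A return time modulo \<open>N * P\<close> is a common return time modulo
  \<open>N\<close> and modulo \<open>P\<close>, so the period is the lcm of \<open>T\<close> and
  \<open>l\<close>. This is \<open>T * (l div gcd T l)\<close>, and the second factor is the order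
  of \<open>q ^ T\<close>.\<close>

lemma cyc_period_mult:
  assumes "N > 0" "P > 0" "coprime N P" "coprime (N * P) q"
  shows "cyc_period q (N * P) x
       = cyc_period q N x * ord (P div nat (gcd x (int P))) (q ^ cyc_period q N x)"
proof -
  define T where "T = cyc_period q N x"
  define l where "l = ord (P div nat (gcd x (int P))) q"
  have cop: "coprime N q" using assms(4) by simp
  have "cyc_period q (N * P) x dvd t \<longleftrightarrow> lcm T l dvd t" for t
  proof -
    have "cyc_period q (N * P) x dvd t \<longleftrightarrow> [x * int q ^ t = x] (mod int N * int P)"
      using assms cong_iff_cyc_period_dvd[of "N * P" q x t] by simp
    also have "\<dots> \<longleftrightarrow> [x * int q ^ t = x] (mod int N) \<and> [x * int q ^ t = x] (mod int P)"
      using coprime_cong_mult[of "x * int q ^ t" x "int N" "int P"]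
        cong_modulus_mult[of "x * int q ^ t" x "int N" "int P"]
        cong_modulus_mult[of "x * int q ^ t" x "int P" "int N"] assms(3)
      unfolding mult.commute[of "int P"] coprime_int_iff by blast
    also have "\<dots> \<longleftrightarrow> T dvd t \<and> l dvd t"
      unfolding T_def l_def
      by (simp only: cong_iff_cyc_period_dvd[OF assms(1) cop] cong_mult_self_iff_ord_dvd[OF assms(2)])
    finally show ?thesis by simp
  qed
  then have "cyc_period q (N * P) x = lcm T l" by (meson dvd_antisym dvd_refl)
  moreover have "lcm T l = T * ord (P div nat (gcd x (int P))) (q ^ T)"
  proof -
    have "T > 0" unfolding T_def by (rule cyc_period_pos[OF assms(1) cop])
    have "lcm T l * gcd T l = T * l" by (metis mult.commute prod_gcd_lcm_nat)
    also have "\<dots> = T * ord (P div nat (gcd x (int P))) (q ^ T) * gcd T l"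
      using ord_power_aux[of "P div nat (gcd x (int P))" q T] by (simp add: l_def mult.assoc)
    finally have "lcm T l * gcd T l = \<dots>" .
    moreover have "gcd T l \<noteq> 0" using \<open>T > 0\<close> by simp
    ultimately show ?thesis by (rule mult_right_cancel[THEN iffD1, rotated])
  qed
  ultimately show ?thesis by (simp add: T_def)
qed

definition gcd_fiber :: "nat \<Rightarrow> nat \<Rightarrow> nat \<Rightarrow> int set \<Rightarrow> nat \<Rightarrow> int set set" where
  "gcd_fiber q N P D d = {E \<in> coset_fiber q N P D. \<exists>x\<in>E. gcd x (int P) = int d}"

lemma card_mem_gcd_fiber:
  assumes "N > 0" "P > 0" "coprime N P" "coprime (N * P) q" "D \<in> cyc_cosets q N"
    and E: "E \<in> gcd_fiber q N P D d"
  shows "card E = card D * ord (P div d) (q ^ card D)"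
proof -
  have pos: "N * P > 0" and cop: "coprime N q" using assms by simp_all
  from E obtain x where x: "x \<in> E" "gcd x (int P) = int d" and "E \<in> cyc_cosets q (N * P)" "coset_proj N E = D"
    by (auto simp: gcd_fiber_def coset_fiber_def)
  then have "E = cyc_coset q (N * P) x" using cyc_cosets_eq_if_mem[OF pos assms(4)] by simp
  moreover from this have "D = cyc_coset q N x"
    using \<open>coset_proj N E = D\<close> assms by (simp add: coset_proj_cyc_coset)
  ultimately show ?thesis
    using cyc_period_mult[OF assms(1-4), of x] x(2) assms(1,4) pos cop
    by (simp add: card_cyc_coset)
qed

text \<open>Passing to the union turns the count of cosets into a count of residues, which the
  Chinese remainder theorem makes explicit.\<close>

lemma Union_gcd_fiber:
  assumes "N > 0" "P > 0" "coprime N P" "coprime (N * P) q" "D \<in> cyc_cosets q N"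
  shows "\<Union> (gcd_fiber q N P D d)
       = {x \<in> {0..<int (N * P)}. x mod int N \<in> D \<and> x mod int P \<in> {y \<in> {0..<int P}. gcd y (int P) = int d}}"
    (is "_ = ?S")
proof -
  have pos: "N * P > 0" using assms by simp
  have gcd_mod: "gcd (x mod int P) (int P) = gcd x (int P)" for x
    by (metis gcd_red_int gcd.commute)
  have S: "x \<in> ?S \<longleftrightarrow> x \<in> {0..<int (N * P)} \<and> x mod int N \<in> D \<and> gcd x (int P) = int d" for x
    using assms(2) by (simp add: gcd_mod)
  show ?thesis
  proof (intro equalityI subsetI)
    fix y assume "y \<in> \<Union> (gcd_fiber q N P D d)"
    then obtain E x where E: "y \<in> E" "E \<in> cyc_cosets q (N * P)" "coset_proj N E = D" "x \<in> E" "gcd x (int P) = int d"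
      by (auto simp: gcd_fiber_def coset_fiber_def)
    have Ex: "E = cyc_coset q (N * P) x" using cyc_cosets_eq_if_mem[OF pos assms(4) E(2,4)] .
    have "gcd y (int P) = int d" using gcd_cyc_coset[OF assms(1,2,4)] E Ex by metis
    moreover have "y \<in> {0..<int (N * P)}" using cyc_coset_subset[OF pos] E(1) Ex by blast
    moreover have "y mod int N \<in> D" using E by (auto simp: coset_proj_def)
    ultimately show "y \<in> ?S" unfolding S by blast
  next
    fix x assume x: "x \<in> ?S"
    let ?E = "cyc_coset q (N * P) x"
    have "x mod int (N * P) = x" using x by (simp add: mod_pos_pos_trivial)
    then have "x \<in> ?E" using mod_in_cyc_coset[OF pos assms(4), of x] by simp
    moreover have "?E \<in> coset_fiber q N P D"
      using x \<open>x \<in> ?E\<close> unfolding coset_fiber_iff[OF assms(1,2,4,5)] S by (auto simp: cyc_cosets_def)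
    ultimately show "x \<in> \<Union> (gcd_fiber q N P D d)" using x unfolding S gcd_fiber_def by blast
  qed
qed

text \<open>The union is counted twice: as disjoint cosets of equal size, and as
  \<open>card D * totient (P div d)\<close> residues. Cancelling \<open>card D\<close> leaves the
  claim, stated as a product to avoid a quotient.\<close>

lemma card_gcd_fiber:
  assumes "N > 0" "P > 0" "coprime N P" "coprime (N * P) q" "D \<in> cyc_cosets q N" "d dvd P"
  shows "finite (gcd_fiber q N P D d)"
    and "card (gcd_fiber q N P D d) * ord (P div d) (q ^ card D) = totient (P div d)"
proof -
  let ?F = "gcd_fiber q N P D d"
  have pos: "N * P > 0" and cop: "coprime N q" using assms by simp_all
  have D: "D \<subseteq> {0..<int N}" using assms(1,5) cyc_coset_subset unfolding cyc_cosets_def by blast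
  then have "finite D" by (rule finite_subset) simp
  moreover have "D \<noteq> {}" using cyc_cosets_nonempty[OF assms(1) cop assms(5)] by blast
  ultimately have "card D > 0" by (simp add: card_gt_0_iff)
  have fin: "finite (\<Union> ?F)" unfolding Union_gcd_fiber[OF assms(1-5)]
    by (rule finite_subset[of _ "{0..<int (N * P)}"]) auto
  then show "finite ?F" by (rule finite_UnionD)
  moreover have "c1 \<inter> c2 = {}" if "c1 \<in> ?F" "c2 \<in> ?F" "c1 \<noteq> c2" for c1 c2
    using that cyc_cosets_eq_if_mem[OF pos assms(4)] unfolding gcd_fiber_def coset_fiber_def by blast
  ultimately have "card D * ord (P div d) (q ^ card D) * card ?F = card (\<Union> ?F)"
    using fin card_mem_gcd_fiber[OF assms(1-5)] by (intro card_partition) auto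
  also have "\<dots> = card D * card {y \<in> {0..<int P}. gcd y (int P) = int d}"
    unfolding Union_gcd_fiber[OF assms(1-5)] by (rule card_residues_product[OF assms(1-3) D]) blast
  also have "\<dots> = card D * totient (P div d)"
    by (simp only: card_residues_gcd[OF assms(6,2)])
  finally show "card ?F * ord (P div d) (q ^ card D) = totient (P div d)"
    using \<open>card D > 0\<close> by (simp add: ac_simps)
qed

section \<open>Adjoining one prime power\<close>

text \<open>In the \<open>local_\<close> definitions \<open>Q\<close> stands for
  \<open>q ^ T\<close>, where \<open>T\<close> is the size of the coset being lifted. They express
  one step of the recursion through \<open>p\<close>, \<open>j\<close> and \<open>Q\<close> alone,
  without the tuple or the position in it.\<close>

definition local_exc :: "nat \<Rightarrow> nat \<Rightarrow> bool" where
  "local_exc p Q \<longleftrightarrow> p = 2 \<and> [Q = 3] (mod 4)"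

definition local_v :: "nat \<Rightarrow> nat \<Rightarrow> nat" where
  "local_v p Q = (if local_exc p Q then multiplicity 2 (Q + 1)
     else multiplicity p (Q ^ ((p - 1) div unit_index p Q) - 1))"

definition local_values :: "nat \<Rightarrow> enat set" where
  "local_values j = enat ` {0..j - 1} \<union> {\<infinity>}"

text \<open>The value \<open>\<infinity>\<close> marks the residue \<open>0\<close> modulo \<open>p\<^sup>j\<close>, whose \<open>gcd\<close> with \<open>p\<^sup>j\<close> is \<open>p\<^sup>j\<close>.\<close>

definition valuation_of :: "nat \<Rightarrow> enat \<Rightarrow> nat" where
  "valuation_of j m = (case m of \<infinity> \<Rightarrow> j | enat i \<Rightarrow> i)"

text \<open>The factor by which the size of a coset grows when it is lifted.\<close>

definition local_size :: "nat \<Rightarrow> nat \<Rightarrow> nat \<Rightarrow> enat \<Rightarrow> nat" where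
  "local_size p j Q m =
     (case m of
        \<infinity> \<Rightarrow> 1
      | enat i \<Rightarrow>
          (if local_exc p Q then (if i = j - 1 then 1 else 2 ^ max 1 (j - i - local_v p Q))
           else p ^ (j - i - local_v p Q) * ((p - 1) div unit_index p Q)))"

definition local_indices :: "nat \<Rightarrow> nat \<Rightarrow> nat \<Rightarrow> enat \<Rightarrow> (nat \<times> nat) set" where
  "local_indices p j Q m =
     {(a, t). case m of
        \<infinity> \<Rightarrow> a = 0 \<and> t = 0
      | enat i \<Rightarrow>
          (if local_exc p Q then
             a = 1 \<and> t \<in> {0..2 ^ min (local_v p Q - 1) (j - i - 2) - 1}
           else
             a \<in> {1..unit_index p Q} \<and> t \<in> {0..p ^ (min (local_v p Q) (j - i) - 1) - 1})}"

lemma local_values_cases: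
  assumes "m \<in> local_values j" "j \<ge> 1"
  obtains "m = \<infinity>" | i where "m = enat i" "i < j"
  using assms by (auto simp: local_values_def)

lemma bij_betw_valuation_of: "j \<ge> 1 \<Longrightarrow> bij_betw (valuation_of j) (local_values j) {..j}"
  by (rule bij_betw_byWitness[of _ "\<lambda>i. if i = j then \<infinity> else enat i"])
    (auto simp: local_values_def valuation_of_def)

lemma unit_index_dvd: "prime p \<Longrightarrow> coprime p Q \<Longrightarrow> unit_index p Q dvd p - 1"
  by (metis dvd_triv_left unit_index_mult_ord)

lemma div_unit_index:
  assumes "prime p" "coprime p Q"
  shows "(p - 1) div unit_index p Q = ord p Q"
proof -
  have "unit_index p Q * ord p Q > 0"
    using unit_index_mult_ord[OF assms] prime_gt_1_nat[OF assms(1)] by simp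
  then show ?thesis unfolding unit_index_mult_ord[OF assms, symmetric] by simp
qed

text \<open>A residue with gcd \<open>p ^ i\<close> leaves the modulus \<open>p ^ (j - i)\<close>,
  and \<open>\<infinity>\<close> leaves modulus 1. The formulas for the order, in the case
  \<open>Q\<close> congruent to 3 modulo 4 for \<open>p = 2\<close> and otherwise, give the two
  branches.\<close>

lemma local_size_eq_ord:
  assumes p: "prime p" and cop: "coprime p Q" and Q: "Q > 1" and m: "m \<in> local_values j" and j: "j \<ge> 1"
  shows "local_size p j Q m = ord (p ^ (j - valuation_of j m)) Q"
  using m j
proof (cases rule: local_values_cases)
  case 1
  then show ?thesis by (simp add: local_size_def valuation_of_def)
next
  case (2 i)
  show ?thesis
  proof (cases "local_exc p Q")
    case True
    then have "ord (p ^ (j - i)) Q = (if j - i \<le> 1 then 1 else 2 ^ max 1 (j - i - local_v p Q))"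
      using ord_two_power_3_mod_4[of Q "j - i"] by (auto simp: local_exc_def local_v_def)
    moreover have "j - i \<le> 1 \<longleftrightarrow> i = j - 1" using 2 j by auto
    ultimately show ?thesis using True 2 by (simp add: local_size_def valuation_of_def)
  next
    case False
    have "p \<noteq> 2 \<or> [Q = 1] (mod 4)"
    proof (cases "p = 2")
      case True
      then have "odd Q" using cop by simp
      then have "Q mod 4 = 1 \<or> Q mod 4 = 3" by presburger
      then show ?thesis using False True by (auto simp: local_exc_def cong_def)
    qed simp
    then have "ord (p ^ (j - i)) Q = ord p Q * p ^ (j - i - multiplicity p (Q ^ ord p Q - 1))"
      using 2 by (intro ord_prime_power p cop Q) auto
    then show ?thesis using False 2
      by (simp add: local_size_def valuation_of_def local_v_def div_unit_index[OF p cop, simplified])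
  qed
qed

text \<open>The ranges of \<open>a\<close> and \<open>t\<close> are what the totient leaves after
  division by the order. Outside the exceptional case, the range of \<open>a\<close> completes
  \<open>ord p Q\<close> to \<open>p - 1\<close>; the range of \<open>t\<close> supplies the missing
  power of \<open>p\<close>.\<close>

lemma card_local_indices:
  assumes p: "prime p" and cop: "coprime p Q" and Q: "Q > 1" and m: "m \<in> local_values j" and j: "j \<ge> 1"
  shows "card (local_indices p j Q m) * local_size p j Q m = totient (p ^ (j - valuation_of j m))"
  using m j
proof (cases rule: local_values_cases)
  case 1
  then have "local_indices p j Q m = {(0, 0)}" by (auto simp: local_indices_def)
  with 1 show ?thesis by (simp add: local_size_def valuation_of_def)
next
  case (2 i)
  define d v where "d = j - i" and "v = local_v p Q"
  have d: "d \<ge> 1" using 2 by (simp add: d_def)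
  have tot: "totient (p ^ (j - valuation_of j m)) = p ^ (d - 1) * (p - 1)"
    using 2 d totient_prime_power_Suc[OF p, of "d - 1"]
    by (simp add: valuation_of_def flip: d_def)
  show ?thesis
  proof (cases "local_exc p Q")
    case True
    define u where "u = min (v - 1) (d - 2)"
    have p2: "p = 2" and Q3: "[Q = 3] (mod 4)" using True by (auto simp: local_exc_def)
    have "[Q + 1 = 3 + 1] (mod 4)" using Q3 by (intro cong_add) auto
    then have "[Q + 1 = 0] (mod 4)" by (simp add: cong_def)
    then have "2 ^ 2 dvd Q + 1" by (simp add: cong_0_iff)
    then have "multiplicity 2 (Q + 1) \<ge> 2" by (intro multiplicity_geI) auto
    then have v: "v \<ge> 2" using True by (simp add: v_def local_v_def)
    have "local_indices p j Q m = {1} \<times> {0..2 ^ u - 1}"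
      using 2 True by (auto simp: local_indices_def u_def d_def v_def)
    then have card: "card (local_indices p j Q m) = 2 ^ u"
      by (simp add: card_cartesian_product)
    have size: "local_size p j Q m = (if d = 1 then 1 else 2 ^ max 1 (d - v))"
      using 2 True d by (auto simp: local_size_def d_def v_def)
    show ?thesis
    proof (cases "d = 1")
      case True
      then show ?thesis unfolding tot card size using p2 by (simp add: u_def)
    next
      case False
      \<comment> \<open>If \<open>v < d\<close>, the summands are \<open>v - 1\<close> and
        \<open>d - v\<close>; otherwise they are \<open>d - 2\<close> and 1. The case
        \<open>d = 1\<close> is separate because \<open>d - 2\<close> truncates there.\<close>
      then have "u + max 1 (d - v) = d - 1" using d v by (cases "v < d") (auto simp: u_def)
      with False show ?thesis unfolding tot card size using p2 by (simp flip: power_add)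
    qed
  next
    case False
    define u where "u = min v d - 1"
    \<comment> \<open>This yields \<open>v \<ge> 1\<close>, so that \<open>min v d - 1\<close> does
      not truncate and the exponents add up to \<open>d - 1\<close>.\<close>
    have "p dvd Q ^ ord p Q - 1" "Q ^ ord p Q > 1"
    proof -
      show gt: "Q ^ ord p Q > 1" using Q cop by (intro one_less_power) auto
      show "p dvd Q ^ ord p Q - 1"
        using ord[of Q p] cong_1_iff_dvd_nat[of "Q ^ ord p Q" p] gt by simp
    qed
    then have "multiplicity p (Q ^ ord p Q - 1) \<ge> 1"
      using p prime_gt_1_nat[OF p] by (intro multiplicity_geI) auto
    then have v: "v \<ge> 1"
      using False by (simp add: v_def local_v_def div_unit_index[OF p cop, simplified])
    have "local_indices p j Q m = {1..unit_index p Q} \<times> {0..p ^ u - 1}"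
      using 2 False by (auto simp: local_indices_def u_def d_def v_def)
    then have card: "card (local_indices p j Q m) = unit_index p Q * p ^ u"
      using prime_gt_0_nat[OF p] by (simp add: card_cartesian_product)
    have size: "local_size p j Q m = p ^ (d - v) * ord p Q"
      using 2 False by (simp add: local_size_def d_def v_def div_unit_index[OF p cop, simplified])
    have "u + (d - v) = d - 1" using d v by (simp add: u_def min_def)
    have "card (local_indices p j Q m) * local_size p j Q m
        = p ^ (u + (d - v)) * (unit_index p Q * ord p Q)"
      by (simp add: card size power_add)
    also have "\<dots> = p ^ (d - 1) * (p - 1)"
      by (simp only: \<open>u + (d - v) = d - 1\<close> unit_index_mult_ord[OF p cop])
    finally show ?thesis by (simp only: tot)
  qed
qed

text \<open>Disjointness of the targets lets the index be recovered from the value. This glues the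
  pieces of one fiber, and later the fibers over different cosets.\<close>

lemma bij_betw_Sigma_UNION:
  assumes "\<And>i. i \<in> I \<Longrightarrow> bij_betw (h i) (A i) (B i)" "\<And>i i'. i \<in> I \<Longrightarrow> i' \<in> I \<Longrightarrow> i \<noteq> i' \<Longrightarrow> B i \<inter> B i' = {}"
  shows "bij_betw (\<lambda>(i, y). h i y) (SIGMA i:I. A i) (\<Union>i\<in>I. B i)"
proof (rule bij_betw_imageI)
  show "inj_on (\<lambda>(i, y). h i y) (SIGMA i:I. A i)"
  proof (rule inj_onI, clarify)
    fix i y i' y' assume *: "i \<in> I" "y \<in> A i" "i' \<in> I" "y' \<in> A i'" "h i y = h i' y'"
    have "h i y \<in> B i" "h i' y' \<in> B i'"
      using bij_betwE[OF assms(1)[OF *(1)]] bij_betwE[OF assms(1)[OF *(3)]] *(2,4) by simp_all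
    then have "i = i'" using *(5) assms(2)[OF *(1,3)] by (metis IntI empty_iff)
    then show "i = i' \<and> y = y'" using * assms(1) by (auto simp: bij_betw_def inj_on_def)
  qed
  have "(\<lambda>(i, y). h i y) ` (SIGMA i:I. A i) = (\<Union>i\<in>I. h i ` A i)"
    unfolding Sigma_def image_UN by auto
  also have "\<dots> = (\<Union>i\<in>I. B i)"
    by (intro SUP_cong refl bij_betw_imp_surj_on assms(1))
  finally show "(\<lambda>(i, y). h i y) ` (SIGMA i:I. A i) = (\<Union>i\<in>I. B i)" .
qed

definition step_indices :: "nat \<Rightarrow> nat \<Rightarrow> nat \<Rightarrow> (enat \<times> nat \<times> nat) set" where
  "step_indices p j Q = (SIGMA m : local_values j. local_indices p j Q m)"

text \<open>The fiber splits by the gcd with \<open>p ^ j\<close>, and each piece has as many cosets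
  as there are local indices, so bijections are chosen piecewise and glued. The sizes are recorded
  because the next step depends on them.\<close>

lemma ex_bij_step:
  assumes N: "N > 0" "coprime N q" "D \<in> cyc_cosets q N" and q: "q > 1"
    and p: "prime p" "coprime p N" "coprime p q" and j: "j \<ge> 1"
  shows "\<exists>g. bij_betw g (step_indices p j (q ^ card D)) (coset_fiber q N (p ^ j) D) \<and>
             (\<forall>z \<in> step_indices p j (q ^ card D). card (g z) = card D * local_size p j (q ^ card D) (fst z))"
proof -
  define Q where "Q = q ^ card D"
  define B where "B = (\<lambda>m. gcd_fiber q N (p ^ j) D (p ^ valuation_of j m))"
  have pj: "p ^ j > 0" "coprime N (p ^ j)" "coprime (N * p ^ j) q"
    using N p by (auto simp: coprime_commute prime_gt_0_nat)
  have pos: "N * p ^ j > 0" using N pj by simp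
  obtain x where x: "x \<in> D" using cyc_cosets_nonempty[OF N] by blast
  have "card D > 0"
    using cyc_cosets_eq_if_mem[OF N x] N by (simp add: card_cyc_coset cyc_period_pos)
  have Q: "Q > 1" "coprime p Q"
    unfolding Q_def using one_less_power[OF q \<open>card D > 0\<close>] p(3) by simp_all
  have val: "valuation_of j m \<le> j" if "m \<in> local_values j" for m
    using bij_betwE[OF bij_betw_valuation_of[OF j]] that by blast
  have div: "p ^ j div p ^ valuation_of j m = p ^ (j - valuation_of j m)" if "m \<in> local_values j" for m
    using val[OF that] p by (simp add: power_diff prime_gt_0_nat)
  have ex: "\<exists>h. bij_betw h (local_indices p j Q m) (B m)" if m: "m \<in> local_values j" for m
  proof -
    have "p ^ valuation_of j m dvd p ^ j" using val[OF m] by (rule le_imp_power_dvd)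
    note card_gcd_fiber[OF N(1) pj(1,2,3) N(3) this]
    then have fin: "finite (B m)" and
      "card (B m) * ord (p ^ (j - valuation_of j m)) Q = totient (p ^ (j - valuation_of j m))"
      unfolding B_def Q_def div[OF m] by auto
    moreover note card_local_indices[OF p(1) Q(2,1) m j]
    moreover have "ord (p ^ (j - valuation_of j m)) Q > 0" using Q by simp
    ultimately have "card (B m) = card (local_indices p j Q m)"
      unfolding local_size_eq_ord[OF p(1) Q(2,1) m j] by (metis mult_right_cancel less_not_refl)
    \<comment> \<open>Positive cardinality yields finiteness, since \<open>card\<close> is 0 on
      infinite sets.\<close>
    moreover have "card (local_indices p j Q m) > 0"
      using card_local_indices[OF p(1) Q(2,1) m j] p(1)
      by (metis mult_eq_0_iff neq0_conv totient_gt_0_iff zero_less_power prime_gt_0_nat)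
    ultimately show ?thesis
      using fin by (intro finite_same_card_bij) (auto intro: card_ge_0_finite)
  qed
  then obtain h where h: "\<And>m. m \<in> local_values j \<Longrightarrow> bij_betw (h m) (local_indices p j Q m) (B m)"
    by metis
  \<comment> \<open>Invariance of the gcd on a coset replaces the existential condition by a
    universal one; disjointness of the pieces follows from it.\<close>
  have B_iff: "E \<in> B m \<longleftrightarrow> E \<in> coset_fiber q N (p ^ j) D \<and> (\<forall>y\<in>E. gcd y (int (p ^ j)) = int (p ^ valuation_of j m))" for E m
  proof (cases "E \<in> coset_fiber q N (p ^ j) D")
    case True
    then have E: "E \<in> cyc_cosets q (N * p ^ j)" by (simp add: coset_fiber_def)
    then obtain x where x: "x \<in> E" using cyc_cosets_nonempty[OF pos pj(3)] by blast
    have eq: "gcd y (int (p ^ j)) = gcd z (int (p ^ j))" if "y \<in> E" "z \<in> E" for y z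
      using gcd_cyc_coset[OF N(1) pj(1,3)] cyc_cosets_eq_if_mem[OF pos pj(3) E] that by metis
    have "(\<exists>y\<in>E. gcd y (int (p ^ j)) = d) \<longleftrightarrow> (\<forall>y\<in>E. gcd y (int (p ^ j)) = d)" for d
      using x eq[OF _ x] by metis
    with True show ?thesis by (simp only: B_def gcd_fiber_def mem_Collect_eq)
  qed (simp add: B_def gcd_fiber_def)
  have disj: "B m \<inter> B m' = {}" if m: "m \<in> local_values j" "m' \<in> local_values j" "m \<noteq> m'" for m m'
  proof -
    from m have "valuation_of j m \<noteq> valuation_of j m'"
      using bij_betw_valuation_of[OF j] by (auto simp: bij_betw_def inj_on_def)
    then have ne: "int (p ^ valuation_of j m) \<noteq> int (p ^ valuation_of j m')"
      using prime_gt_1_nat[OF p(1)] by (simp add: power_inject_exp)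
    show "B m \<inter> B m' = {}"
    proof (rule ccontr)
      assume "B m \<inter> B m' \<noteq> {}"
      then obtain E where E: "E \<in> B m" "E \<in> B m'" by blast
      then have "E \<in> cyc_cosets q (N * p ^ j)" by (simp add: B_iff coset_fiber_def)
      then obtain x where "x \<in> E" using cyc_cosets_nonempty[OF pos pj(3)] by blast
      with E ne show False by (simp add: B_iff)
    qed
  qed
  note bij = bij_betw_Sigma_UNION[of "local_values j" h, OF h disj]
  have "(\<Union>m\<in>local_values j. B m) = coset_fiber q N (p ^ j) D"
  proof (intro equalityI subsetI)
    fix E assume E: "E \<in> coset_fiber q N (p ^ j) D"
    then obtain x where x: "x \<in> E"
      using cyc_cosets_nonempty[OF pos pj(3)] by (auto simp: coset_fiber_def)
    have "nat (gcd x (int (p ^ j))) dvd p ^ j"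
      by (subst int_dvd_int_iff[symmetric]) simp
    then obtain i where i: "i \<le> j" "nat (gcd x (int (p ^ j))) = p ^ i"
      using divides_primepow_nat[OF p(1)] by blast
    moreover obtain m where m: "m \<in> local_values j" "valuation_of j m = i"
      using bij_betw_valuation_of[OF j] \<open>i \<le> j\<close> unfolding bij_betw_def by force
    ultimately have "gcd x (int (p ^ j)) = int (p ^ valuation_of j m)"
      by (metis gcd_ge_0_int int_nat_eq)
    then have "E \<in> B m" using E x unfolding B_def gcd_fiber_def by blast
    with m show "E \<in> (\<Union>m\<in>local_values j. B m)" by blast
  qed (auto simp: B_iff)
  with bij have "bij_betw (\<lambda>(m, y). h m y) (step_indices p j Q) (coset_fiber q N (p ^ j) D)"
    by (simp add: step_indices_def)
  moreover have "card (h m y) = card D * local_size p j Q m"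
    if "m \<in> local_values j" "y \<in> local_indices p j Q m" for m y
  proof -
    have "h m y \<in> B m" using h that by (auto simp: bij_betw_def)
    then show ?thesis
      using card_mem_gcd_fiber[OF N(1) pj(1,2,3) N(3)] local_size_eq_ord[OF p(1) Q(2,1) that(1) j]
      by (simp add: B_def div[OF that(1)] Q_def)
  qed
  ultimately show ?thesis
    unfolding Q_def[symmetric]
    by (intro exI[of _ "\<lambda>(m, y). h m y"]) (auto simp: step_indices_def)
qed

section \<open>The tower of prime powers\<close>

lemma restrict_upd_extensional:
  "h \<in> extensional {1..Suc k} \<Longrightarrow> (restrict h {1..k})(Suc k := h (Suc k)) = h"
  by (auto simp: fun_eq_iff restrict_def extensional_def)

lemma upd_restrict_extensional:
  "h \<in> extensional {1..k} \<Longrightarrow> restrict (h(Suc k := y)) {1..k} = h"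
  by (auto simp: fun_eq_iff restrict_def extensional_def)

lemma extensional_upd:
  "h \<in> extensional {1..k} \<Longrightarrow> h(Suc k := y) \<in> extensional {1..Suc k}"
  by (auto simp: extensional_def)

locale cyclotomic_tower =
  fixes q n s \<tau> :: nat and ps js :: "nat \<Rightarrow> nat" and C :: "int set"
  assumes q: "q > 1" and n: "n > 0" "coprime n q"
    and ps_mono: "strict_mono_on {1..s} ps"
    and ps: "\<And>k. k \<in> {1..s} \<Longrightarrow> prime (ps k) \<and> coprime (ps k) q \<and> coprime (ps k) n"
    and js: "\<And>k. k \<in> {1..s} \<Longrightarrow> js k \<ge> 1"
    and C: "C \<in> cyc_cosets q n"
    and tau: "\<tau> = card C"
begin

abbreviation tau_upto :: "(nat \<Rightarrow> enat) \<Rightarrow> nat \<Rightarrow> nat" where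
  "tau_upto m k \<equiv> tau_seq q \<tau> ps js m k"

abbreviation modulus :: "nat \<Rightarrow> nat" where
  "modulus k \<equiv> \<Prod>i=1..k. ps i ^ js i"

text \<open>At the first position \<open>tau_upto m 0\<close> is \<open>\<tau>\<close>. At later
  positions the prime exceeds \<open>ps 1\<close>, hence 2, because the primes increase, and neither
  side holds.\<close>

lemma exc2_iff:
  assumes "Suc k \<le> s"
  shows "exc2 q \<tau> ps (Suc k) \<longleftrightarrow> local_exc (ps (Suc k)) (q ^ tau_upto m k)"
proof (cases "k = 0")
  case True
  then show ?thesis by (simp add: exc2_def local_exc_def)
next
  case False
  have "prime (ps 1)" using ps[of 1] assms by simp
  then have "2 \<le> ps 1" by (rule prime_ge_2_nat)
  also have "ps 1 < ps (Suc k)"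
    using assms False by (intro strict_mono_onD[OF ps_mono]) auto
  finally show ?thesis using False by (simp add: exc2_def local_exc_def)
qed

text \<open>The index divides \<open>p - 1\<close>, so the division can be moved inside the product
  and the exponent of \<open>q\<close> becomes an exponent of
  \<open>q ^ tau_upto m k\<close>.\<close>

lemma v_seq_Suc:
  assumes "Suc k \<le> s"
  shows "v_seq q \<tau> ps js m (Suc k) = local_v (ps (Suc k)) (q ^ tau_upto m k)"
proof -
  let ?p = "ps (Suc k)" and ?Q = "q ^ tau_upto m k"
  have p: "prime ?p" "coprime ?p q" using ps[of "Suc k"] assms by auto
  then have "unit_index ?p ?Q dvd ?p - 1" by (intro unit_index_dvd) auto
  then have "tau_upto m k * (?p - 1) div unit_index ?p ?Q = tau_upto m k * ((?p - 1) div unit_index ?p ?Q)"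
    by (simp only: div_mult_swap)
  moreover have "\<tau> = tau_upto m k" if "exc2 q \<tau> ps (Suc k)"
    using that by (simp add: exc2_def)
  ultimately show ?thesis
    using exc2_iff[OF assms, of m] by (auto simp: local_v_def power_mult)
qed

lemma tau_seq_Suc:
  assumes "Suc k \<le> s"
  shows "tau_upto m (Suc k)
       = tau_upto m k * local_size (ps (Suc k)) (js (Suc k)) (q ^ tau_upto m k) (m (Suc k))"
proof -
  have "\<tau> = tau_upto m k" if "exc2 q \<tau> ps (Suc k)"
    using that by (simp add: exc2_def)
  then show ?thesis
    using exc2_iff[OF assms, of m]
    unfolding tau_seq.simps(2) local_size_def v_seq_Suc[OF assms] r_seq.simps
    by (simp split: enat.split)
qed

lemma tau_seq_cong:
  assumes "\<And>i. i \<in> {1..k} \<Longrightarrow> m i = m' i" "k \<le> s"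
  shows "tau_upto m k = tau_upto m' k"
  using assms
proof (induction k)
  case (Suc k)
  then have "tau_upto m k = tau_upto m' k" by simp
  with Suc.prems show ?case by (simp only: tau_seq_Suc) simp
qed simp

text \<open>The admissible triples at position \<open>Suc k\<close>; they depend on the first
  \<open>k\<close> entries of \<open>m\<close> only.\<close>

definition step_at :: "(nat \<Rightarrow> enat) \<Rightarrow> nat \<Rightarrow> (enat \<times> nat \<times> nat) set" where
  "step_at m k = step_indices (ps (Suc k)) (js (Suc k)) (q ^ tau_upto m k)"

lemma step_at_cong:
  assumes "\<And>i. i \<in> {1..k} \<Longrightarrow> m i = m' i" "k \<le> s"
  shows "step_at m k = step_at m' k"
  by (simp only: step_at_def tau_seq_cong[OF assms])

text \<open>Membership becomes one local condition per position, with positions shifted to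
  \<open>Suc i\<close>, so that a tuple can be built entry by entry.\<close>

lemma index_set_iff:
  assumes "k \<le> s"
  shows "(m, a, t) \<in> index_set q \<tau> k ps js \<longleftrightarrow>
    m \<in> extensional {1..k} \<and> a \<in> extensional {1..k} \<and> t \<in> extensional {1..k} \<and>
    (\<forall>i<k. (m (Suc i), a (Suc i), t (Suc i)) \<in> step_at m i)"
proof -
  define R where "R i \<longleftrightarrow>
    (case m i of
       \<infinity> \<Rightarrow> a i = 0 \<and> t i = 0
     | enat l \<Rightarrow>
         (if exc2 q \<tau> ps i then
            a i = 1 \<and> t i \<in> {0..2 ^ min (v_seq q \<tau> ps js m i - 1) (js i - l - 2) - 1}
          else
            a i \<in> {1..r_seq q \<tau> ps js m i} \<and>
            t i \<in> {0..ps i ^ (min (v_seq q \<tau> ps js m i) (js i - l) - 1) - 1}))" for i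
  have "R (Suc i) \<longleftrightarrow>
      (a (Suc i), t (Suc i)) \<in> local_indices (ps (Suc i)) (js (Suc i)) (q ^ tau_upto m i) (m (Suc i))"
    if "i < k" for i
  proof -
    have i: "Suc i \<le> s" using that assms by simp
    show ?thesis
      unfolding R_def local_indices_def v_seq_Suc[OF i] exc2_iff[OF i, of m] r_seq.simps
      by simp
  qed
  then have R: "m (Suc i) \<in> local_values (js (Suc i)) \<and> R (Suc i) \<longleftrightarrow>
      (m (Suc i), a (Suc i), t (Suc i)) \<in> step_at m i" if "i < k" for i
    using that by (simp only: step_at_def step_indices_def mem_Sigma_iff)
  have "(m, a, t) \<in> index_set q \<tau> k ps js \<longleftrightarrow>
      m \<in> extensional {1..k} \<and> a \<in> extensional {1..k} \<and> t \<in> extensional {1..k} \<and>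
      (\<forall>i\<in>{1..k}. m i \<in> local_values (js i) \<and> R i)"
    unfolding index_set_def m_tuples_def at_tuples_def local_values_def R_def[symmetric]
      mem_Sigma_iff PiE_iff mem_Collect_eq case_prod_conv by blast
  also have "(\<forall>i\<in>{1..k}. m i \<in> local_values (js i) \<and> R i) \<longleftrightarrow>
      (\<forall>i<k. m (Suc i) \<in> local_values (js (Suc i)) \<and> R (Suc i))"
    unfolding image_Suc_lessThan[symmetric] by blast
  also have "\<dots> \<longleftrightarrow> (\<forall>i<k. (m (Suc i), a (Suc i), t (Suc i)) \<in> step_at m i)"
    using R by blast
  finally show ?thesis .
qed

text \<open>Cutting off and appending the last triple are mutually inverse on extensional tuples.
  Neither changes the earlier conditions, since \<open>step_at m i\<close> with
  \<open>i \<le> k\<close> ignores the entry at \<open>Suc k\<close>.\<close>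

lemma bij_betw_index_set_Suc:
  assumes "Suc k \<le> s"
  shows "bij_betw (\<lambda>(m, a, t). ((restrict m {1..k}, restrict a {1..k}, restrict t {1..k}), m (Suc k), a (Suc k), t (Suc k)))
    (index_set q \<tau> (Suc k) ps js) (SIGMA z : index_set q \<tau> k ps js. step_at (fst z) k)"
proof (rule bij_betw_byWitness[where f' =
      "\<lambda>((m, a, t), (\<mu>, \<alpha>, \<beta>)). (m(Suc k := \<mu>), a(Suc k := \<alpha>), t(Suc k := \<beta>))"]; intro ballI image_subsetI)
  let ?f = "\<lambda>(m, a, t). ((restrict m {1..k}, restrict a {1..k}, restrict t {1..k}), m (Suc k), a (Suc k), t (Suc k))"
  let ?g = "\<lambda>((m, a, t), (\<mu>, \<alpha>, \<beta>)). (m(Suc k := \<mu>), a(Suc k := \<alpha>), t(Suc k := \<beta>))"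
  have k: "k \<le> s" using assms by simp
  fix x assume "x \<in> index_set q \<tau> (Suc k) ps js"
  then obtain m a t where x: "x = (m, a, t)" "(m, a, t) \<in> index_set q \<tau> (Suc k) ps js"
    by (cases x) auto
  note mem = x(2)[unfolded index_set_iff[OF assms]]
  show "?g (?f x) = x" using mem
    by (simp only: x(1) case_prod_conv restrict_upd_extensional)
  have "step_at (restrict m {1..k}) i = step_at m i" if "i \<le> k" for i
    using that k by (intro step_at_cong) auto
  then have "(restrict m {1..k}, restrict a {1..k}, restrict t {1..k}) \<in> index_set q \<tau> k ps js"
    "(m (Suc k), a (Suc k), t (Suc k)) \<in> step_at (restrict m {1..k}) k"
    using mem by (auto simp: index_set_iff[OF k])
  then show "?f x \<in> (SIGMA z : index_set q \<tau> k ps js. step_at (fst z) k)"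
    by (simp add: x(1))
next
  let ?f = "\<lambda>(m, a, t). ((restrict m {1..k}, restrict a {1..k}, restrict t {1..k}), m (Suc k), a (Suc k), t (Suc k))"
  let ?g = "\<lambda>((m, a, t), (\<mu>, \<alpha>, \<beta>)). (m(Suc k := \<mu>), a(Suc k := \<alpha>), t(Suc k := \<beta>))"
  have k: "k \<le> s" using assms by simp
  fix x assume "x \<in> (SIGMA z : index_set q \<tau> k ps js. step_at (fst z) k)"
  then obtain m a t \<mu> \<alpha> \<beta> where x: "x = ((m, a, t), (\<mu>, \<alpha>, \<beta>))" "(m, a, t) \<in> index_set q \<tau> k ps js" 
    "(\<mu>, \<alpha>, \<beta>) \<in> step_at m k"
    by (cases x) auto
  note mem = x(2)[unfolded index_set_iff[OF k]]
  show "?f (?g x) = x" using mem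
    by (simp only: x(1) case_prod_conv upd_restrict_extensional fun_upd_same)
  have "step_at (m(Suc k := \<mu>)) i = step_at m i" if "i \<le> k" for i
    using that k by (intro step_at_cong) auto
  then show "?g x \<in> index_set q \<tau> (Suc k) ps js"
    using mem x(3) by (auto simp: x(1) index_set_iff[OF assms] extensional_upd less_Suc_eq simp del: One_nat_def)
qed

section \<open>The induction along the tower of moduli\<close>

lemma modulus_props:
  assumes "k \<le> s"
  shows "n * modulus k > 0" "coprime (n * modulus k) q"
    "Suc k \<le> s \<Longrightarrow> coprime (ps (Suc k)) (n * modulus k)"
proof -
  have pr: "prime (ps i)" "coprime (ps i) q" if "i \<in> {1..k}" for i using ps[of i] that assms by auto
  then have "modulus k > 0" by (intro prod_pos) (auto simp: prime_gt_0_nat)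
  then show "n * modulus k > 0" using n by simp
  have "coprime (modulus k) q" using pr by (intro prod_coprime_left) auto
  then show "coprime (n * modulus k) q" using n by simp
  assume k: "Suc k \<le> s"
  have "coprime (ps (Suc k)) (ps i)" if "i \<in> {1..k}" for i
  proof -
    have "ps i < ps (Suc k)" using that k by (intro strict_mono_onD[OF ps_mono]) auto
    then show ?thesis using pr(1)[OF that] ps[of "Suc k"] k by (intro primes_coprime) auto
  qed
  then have "coprime (ps (Suc k)) (modulus k)" by (intro prod_coprime_right) auto
  then show "coprime (ps (Suc k)) (n * modulus k)" using ps[of "Suc k"] k by simp
qed

text \<open>Projections compose, so every coset over \<open>C\<close> at the next level passes
  through an intermediate coset over \<open>C\<close>, namely its own projection.\<close>

lemma coset_fiber_Suc:
  assumes "Suc k \<le> s"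
  shows "coset_fiber q n (modulus (Suc k)) C
       = (\<Union>D \<in> coset_fiber q n (modulus k) C. coset_fiber q (n * modulus k) (ps (Suc k) ^ js (Suc k)) D)"
proof -
  let ?N = "n * modulus k" and ?P = "ps (Suc k) ^ js (Suc k)"
  have k: "k \<le> s" using assms by simp
  have N: "?N > 0" "coprime ?N q" using modulus_props[OF k] by auto
  have P: "?P > 0" "coprime (?N * ?P) q"
    using ps[of "Suc k"] assms N by (auto simp: prime_gt_0_nat)
  have mod: "n * modulus (Suc k) = ?N * ?P" by (simp add: mult.assoc)
  have proj: "coset_proj n (coset_proj ?N E) = coset_proj n E" for E
    by (simp add: coset_proj_def image_image mod_mod_cancel)
  have "coset_proj ?N E \<in> cyc_cosets q ?N" if "E \<in> cyc_cosets q (?N * ?P)" for E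
    using that coset_proj_cyc_coset[OF N(1) P] by (auto simp: cyc_cosets_def)
  then have "E \<in> cyc_cosets q (?N * ?P) \<and> coset_proj n E = C \<longleftrightarrow>
      (\<exists>D. (D \<in> cyc_cosets q ?N \<and> coset_proj n D = C) \<and> E \<in> cyc_cosets q (?N * ?P) \<and> coset_proj ?N E = D)" for E
    using proj[of E] by metis
  then show ?thesis
    unfolding coset_fiber_def mod by blast
qed

text \<open>The statement on sizes belongs to the induction: the local indices above
  \<open>f z\<close> depend on \<open>card (f z)\<close>, while the index set is defined through
  \<open>tau_upto\<close>.\<close>

lemma ex_bij_index_set:
  "k \<le> s \<Longrightarrow> \<exists>f. bij_betw f (index_set q \<tau> k ps js) (coset_fiber q n (modulus k) C) \<and>
     (\<forall>z \<in> index_set q \<tau> k ps js. card (f z) = tau_upto (fst z) k)"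
proof (induction k)
  case 0
  let ?u = "\<lambda>_. undefined"
  have "index_set q \<tau> 0 ps js = {(?u, ?u, ?u)}"
    by (auto simp: index_set_iff)
  moreover have "coset_proj n E = E" if "E \<in> cyc_cosets q n" for E
  proof -
    have "x mod int n = x" if "x \<in> E" for x
      using cyc_coset_subset[OF n(1)] \<open>E \<in> cyc_cosets q n\<close> that unfolding cyc_cosets_def
      by (fastforce simp: mod_pos_pos_trivial)
    then show ?thesis by (simp add: coset_proj_def)
  qed
  then have "coset_fiber q n (modulus 0) C = {C}"
    using C by (auto simp: coset_fiber_def)
  ultimately show ?case
    by (intro exI[of _ "\<lambda>_. C"]) (simp add: bij_betw_def tau)
next
  case (Suc k)
  let ?N = "n * modulus k" and ?p = "ps (Suc k)" and ?j = "js (Suc k)"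
  let ?I = "index_set q \<tau> k ps js"
  have k: "k \<le> s" using Suc.prems by simp
  obtain f where f: "bij_betw f ?I (coset_fiber q n (modulus k) C)"
    and card_f: "\<And>z. z \<in> ?I \<Longrightarrow> card (f z) = tau_upto (fst z) k"
    using Suc.IH[OF k] by blast
  have fib: "f z \<in> coset_fiber q n (modulus k) C" if "z \<in> ?I" for z
    using bij_betwE[OF f] that by blast
  have "\<forall>z\<in>?I. \<exists>g. bij_betw g (step_at (fst z) k) (coset_fiber q ?N (?p ^ ?j) (f z)) \<and>
      (\<forall>y \<in> step_at (fst z) k. card (g y) = card (f z) * local_size ?p ?j (q ^ card (f z)) (fst y))"
  proof
    fix z assume z: "z \<in> ?I"
    show "\<exists>g. bij_betw g (step_at (fst z) k) (coset_fiber q ?N (?p ^ ?j) (f z)) \<and>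
      (\<forall>y \<in> step_at (fst z) k. card (g y) = card (f z) * local_size ?p ?j (q ^ card (f z)) (fst y))"
      \<comment> \<open>The sizes from the induction hypothesis turn \<open>tau_upto\<close> into
        \<open>card (f z)\<close>, the form in which a single step was proved.\<close>
      unfolding step_at_def card_f[OF z, symmetric]
    proof (rule ex_bij_step)
      show "f z \<in> cyc_cosets q ?N" using fib[OF z] by (simp add: coset_fiber_def)
    qed (use modulus_props[OF k] ps[of "Suc k"] js[of "Suc k"] Suc.prems q in auto)
  qed
  from bchoice[OF this] obtain g where G: "\<forall>z\<in>?I. bij_betw (g z) (step_at (fst z) k) (coset_fiber q ?N (?p ^ ?j) (f z)) \<and>
      (\<forall>y \<in> step_at (fst z) k. card (g z y) = card (f z) * local_size ?p ?j (q ^ card (f z)) (fst y))" ..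
  then have g: "bij_betw (g z) (step_at (fst z) k) (coset_fiber q ?N (?p ^ ?j) (f z))" if "z \<in> ?I" for z
    using that by blast
  have card_g: "card (g z y) = card (f z) * local_size ?p ?j (q ^ card (f z)) (fst y)"
    if "z \<in> ?I" "y \<in> step_at (fst z) k" for z y
    using G that by blast
  \<comment> \<open>A coset has only one projection, so fibers over the distinct cosets
    \<open>f z\<close> and \<open>f z'\<close> are disjoint.\<close>
  have "coset_fiber q ?N (?p ^ ?j) (f z) \<inter> coset_fiber q ?N (?p ^ ?j) (f z') = {}"
    if "z \<in> ?I" "z' \<in> ?I" "z \<noteq> z'" for z z'
  proof -
    have "f z \<noteq> f z'" using f that by (auto simp: bij_betw_def inj_on_def)
    then show ?thesis by (auto simp: coset_fiber_def)
  qed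
  note bij = bij_betw_Sigma_UNION[of ?I g, OF g this]
  have "(\<Union>z\<in>?I. coset_fiber q ?N (?p ^ ?j) (f z)) = coset_fiber q n (modulus (Suc k)) C"
    unfolding coset_fiber_Suc[OF Suc.prems] bij_betw_imp_surj_on[OF f, symmetric] by simp
  with bij have bij: "bij_betw (\<lambda>(z, y). g z y) (SIGMA z : ?I. step_at (fst z) k) (coset_fiber q n (modulus (Suc k)) C)"
    by simp
  let ?\<phi> = "\<lambda>(m, a, t). ((restrict m {1..k}, restrict a {1..k}, restrict t {1..k}), m (Suc k), a (Suc k), t (Suc k))"
  note \<phi> = bij_betw_index_set_Suc[OF Suc.prems]
  have "card (((\<lambda>(z, y). g z y) \<circ> ?\<phi>) x) = tau_upto (fst x) (Suc k)" if x: "x \<in> index_set q \<tau> (Suc k) ps js" for x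
  proof -
    obtain m a t where xm: "x = (m, a, t)" by (cases x)
    let ?m = "restrict m {1..k}"
    have mem: "(?m, restrict a {1..k}, restrict t {1..k}) \<in> ?I" "(m (Suc k), a (Suc k), t (Suc k)) \<in> step_at ?m k"
      using bij_betwE[OF \<phi>] x unfolding xm by auto
    have "tau_upto ?m k = tau_upto m k" using k by (intro tau_seq_cong) auto
    then show ?thesis
      using card_g[OF mem(1)] card_f[OF mem(1)] mem(2) by (simp only: xm tau_seq_Suc[OF Suc.prems]) simp
  qed
  then show ?case
    using bij_betw_trans[OF \<phi> bij] by blast
qed

end

theorem theorem7p1:
  fixes p e q n n' s \<tau> :: nat and ps js :: "nat \<Rightarrow> nat" and \<gamma> :: int
  assumes "prime p" and "e \<ge> 1" and "q = p ^ e"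
    and "n \<ge> 1" and "coprime n q"
    and "strict_mono_on {1..s} ps"
    and "\<And>k. k \<in> {1..s} \<Longrightarrow> prime (ps k) \<and> ps k \<noteq> p \<and> \<not> ps k dvd n"
    and "\<And>k. k \<in> {1..s} \<Longrightarrow> js k \<ge> 1"
    and "n' = (\<Prod>k=1..s. ps k ^ js k)"
    and "\<tau> = card (cyc_coset q n \<gamma>)"
  shows "\<exists>f. bij_betw f (index_set q \<tau> s ps js) (coset_fiber q n n' (cyc_coset q n \<gamma>))"
proof -
  interpret cyclotomic_tower q n s \<tau> ps js "cyc_coset q n \<gamma>"
  proof
    show "q > 1" using one_less_power[OF prime_gt_1_nat[OF assms(1)], of e] assms(2,3) by simp
    show "prime (ps k) \<and> coprime (ps k) q \<and> coprime (ps k) n" if "k \<in> {1..s}" for k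
      using assms(7)[OF that] assms(1,3) primes_coprime[of "ps k" p] prime_imp_coprime[of "ps k" n]
      by auto
  qed (use assms in \<open>auto simp: cyc_cosets_def\<close>)
  show ?thesis using ex_bij_index_set[of s] assms(9) by auto
qed

end
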